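(* Let $B$ be a graphic matroid. Then the es-splitting matroid $B_X^e$ is a binary gammoid for every $X \subseteq E(B)$ with $|X| \geq 2$ and every $e \in X$ if and only if $B$ has no minor isomorphic to $M(G_8)$, where $G_8$ is the graph with vertices $t,a,b$ and four edges: one edge between $t$ and $a$, one edge between $t$ and $b$, and two parallel edges between $a$ and $b$.
   Context: Element splitting: let $D$ be a binary matroid represented over $GF(2)$ by a matrix $N$, and let $X \subseteq E(D)$. Let $N_X'$ be obtained from $N$ by appending a new last row with entry $1$ in the columns of the elements of $X$ and $0$ elsewhere, and then appending a new column labelled $q$ with entry $1$ in the new row and $0$ elsewhere; the element splitting matroid is $D_X' = M(N_X')$. es-splitting: let $B$ be a binary matroid represented by a matrix $A$, $X \subseteq E(B)$ and $e \in X$. Let $N$ be obtained from $A$ by adding a new column labelled $\gamma$ identical to the column of $e$, and let $D = M(N)$. The es-splitting matroid $B_X^e$ is the element splitting matroid $D_X'$ (with $X$ viewed as a subset of $E(D)$). A binary gammoid is a matroid that is both binary and a gammoid (equivalently, one with no minor isomorphic to $U_{2,4}$ or $M(K_4)$). $M(G)$ is the cycle matroid of $G$. *)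

theory Defs
  imports "HOL-Library.Z2" "Graph_Theory.Graph_Theory"
begin

record 'e matroid =
  ground :: "'e set"
  indeps :: "'e set set"

definition matroid :: "'e matroid \<Rightarrow> bool" where
  "matroid M \<longleftrightarrow>
     finite (ground M) \<and>
     indeps M \<subseteq> Pow (ground M) \<and>
     {} \<in> indeps M \<and>
     (\<forall>I\<in>indeps M. \<forall>J. J \<subseteq> I \<longrightarrow> J \<in> indeps M) \<and>
     (\<forall>I\<in>indeps M. \<forall>J\<in>indeps M. card I < card J \<longrightarrow>
        (\<exists>x\<in>J - I. insert x I \<in> indeps M))"

definition matroid_iso :: "'e matroid \<Rightarrow> 'f matroid \<Rightarrow> bool" where
  "matroid_iso M N \<longleftrightarrow>
     (\<exists>f. bij_betw f (ground M) (ground N) \<and>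
          (\<forall>I. I \<subseteq> ground M \<longrightarrow> (I \<in> indeps M \<longleftrightarrow> f ` I \<in> indeps N)))"

definition basis_of :: "'e matroid \<Rightarrow> 'e set \<Rightarrow> 'e set \<Rightarrow> bool" where
  "basis_of M S J \<longleftrightarrow>
     J \<subseteq> S \<and> J \<in> indeps M \<and> (\<forall>K. J \<subseteq> K \<and> K \<subseteq> S \<and> K \<in> indeps M \<longrightarrow> K = J)"

definition deletion :: "'e matroid \<Rightarrow> 'e set \<Rightarrow> 'e matroid" where
  "deletion M S = \<lparr>ground = ground M - S, indeps = {I \<in> indeps M. I \<subseteq> ground M - S}\<rparr>"

definition contraction :: "'e matroid \<Rightarrow> 'e set \<Rightarrow> 'e matroid" where
  "contraction M S =
     \<lparr>ground = ground M - S,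
      indeps = {I. I \<subseteq> ground M - S \<and> (\<exists>J. basis_of M S J \<and> I \<union> J \<in> indeps M)}\<rparr>"

definition has_minor_iso :: "'e matroid \<Rightarrow> 'f matroid \<Rightarrow> bool" where
  "has_minor_iso M N \<longleftrightarrow>
     (\<exists>S T. S \<subseteq> ground M \<and> T \<subseteq> ground M \<and> S \<inter> T = {} \<and>
            matroid_iso (deletion (contraction M S) T) N)"

text \<open>
  Matrices over GF(2) with rows \<open>0, \<dots>, nrows - 1\<close> and columns labelled by the elements of
  \<open>cols\<close>; entries outside this range are irrelevant.
\<close>

record 'e bmatrix =
  nrows :: nat
  cols :: "'e set"
  entry :: "nat \<Rightarrow> 'e \<Rightarrow> bit"

definition vector_matroid :: "'e bmatrix \<Rightarrow> 'e matroid" where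
  "vector_matroid N =
     \<lparr>ground = cols N,
      indeps = {I. I \<subseteq> cols N \<and>
                   (\<forall>c :: 'e \<Rightarrow> bit. (\<forall>i<nrows N. (\<Sum>x\<in>I. c x * entry N i x) = 0) \<longrightarrow>
                                  (\<forall>x\<in>I. c x = 0))}\<rparr>"

definition binary_matroid :: "'e matroid \<Rightarrow> bool" where
  "binary_matroid M \<longleftrightarrow> matroid M \<and> (\<exists>N. vector_matroid N = M)"

text \<open>
  The matrix \<open>N'\<^sub>X\<close> of the element splitting; an old label \<open>y\<close> becomes \<open>Some y\<close> and the new
  label \<open>q\<close> is \<open>None\<close>.
\<close>

definition element_splitting_matrix :: "'e bmatrix \<Rightarrow> 'e set \<Rightarrow> 'e option bmatrix" where
  "element_splitting_matrix N X =
     \<lparr>nrows = Suc (nrows N),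
      cols = insert None (Some ` cols N),
      entry = (\<lambda>i x. case x of
                 None \<Rightarrow> (if i = nrows N then 1 else 0)
               | Some y \<Rightarrow> (if i = nrows N then (if y \<in> X then 1 else 0) else entry N i y))\<rparr>"

definition element_splitting :: "'e bmatrix \<Rightarrow> 'e set \<Rightarrow> 'e option matroid" where
  "element_splitting N X = vector_matroid (element_splitting_matrix N X)"

text \<open>Here \<open>None\<close> is the label \<open>\<gamma>\<close> of the added copy of the column of \<open>e\<close>.\<close>

definition add_parallel_column :: "'e bmatrix \<Rightarrow> 'e \<Rightarrow> 'e option bmatrix" where
  "add_parallel_column A e =
     \<lparr>nrows = nrows A,
      cols = insert None (Some ` cols A),
      entry = (\<lambda>i x. case x of None \<Rightarrow> entry A i e | Some y \<Rightarrow> entry A i y)\<rparr>"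

text \<open>
  The matroid \<open>B\<^sub>X\<^sup>e\<close> for \<open>B = vector_matroid A\<close>: an element \<open>y\<close> of \<open>B\<close> is \<open>Some (Some y)\<close>,
  \<open>\<gamma>\<close> is \<open>Some None\<close> and \<open>q\<close> is \<open>None\<close>.
\<close>

definition es_splitting :: "'e bmatrix \<Rightarrow> 'e set \<Rightarrow> 'e \<Rightarrow> 'e option option matroid" where
  "es_splitting A X e = element_splitting (add_parallel_column A e) (Some ` X)"

text \<open>
  Undirected multigraphs; the set of ends of an edge has one element (a loop) or two.
\<close>

record ('v, 'e) multigraph =
  gverts :: "'v set"
  gedges :: "'e set"
  gends :: "'e \<Rightarrow> 'v set"

definition finite_multigraph :: "('v, 'e) multigraph \<Rightarrow> bool" where
  "finite_multigraph G \<longleftrightarrow>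
     finite (gverts G) \<and> finite (gedges G) \<and>
     (\<forall>e\<in>gedges G. gends G e \<subseteq> gverts G \<and> card (gends G e) \<in> {1, 2})"

text \<open>
  Edge sets of cycles: \<open>vs ! 0, es ! 0, vs ! 1, es ! 1, \<dots>\<close> is a closed walk without repeated
  vertices or edges. Length 1 gives the loops and length 2 the pairs of parallel edges.
\<close>

definition cycle_edges :: "('v, 'e) multigraph \<Rightarrow> 'e set \<Rightarrow> bool" where
  "cycle_edges G C \<longleftrightarrow>
     (\<exists>vs es. es \<noteq> [] \<and> length vs = length es \<and> distinct vs \<and> distinct es \<and>
        set vs \<subseteq> gverts G \<and> set es \<subseteq> gedges G \<and> C = set es \<and>
        (\<forall>i<length es. gends G (es ! i) = {vs ! i, vs ! (Suc i mod length es)}))"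

definition cycle_matroid :: "('v, 'e) multigraph \<Rightarrow> 'e matroid" where
  "cycle_matroid G =
     \<lparr>ground = gedges G,
      indeps = {I. I \<subseteq> gedges G \<and> \<not> (\<exists>C. C \<subseteq> I \<and> cycle_edges G C)}\<rparr>"

text \<open>
  Since graphs are finite and everything is up to isomorphism, it is no restriction to take
  natural numbers as vertices and edges, here and for the digraphs presenting gammoids.
\<close>

definition graphic_matroid :: "'e matroid \<Rightarrow> bool" where
  "graphic_matroid M \<longleftrightarrow>
     matroid M \<and>
     (\<exists>G :: (nat, nat) multigraph. finite_multigraph G \<and> matroid_iso M (cycle_matroid G))"

text \<open>
  \<open>linked_into G S I\<close>: there are pairwise vertex-disjoint directed paths in \<open>G\<close>, one starting at
  each vertex in \<open>I\<close>, all ending in \<open>S\<close>. A path may consist of a single vertex.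
\<close>

definition linked_into :: "('v, 'a) pre_digraph \<Rightarrow> 'v set \<Rightarrow> 'v set \<Rightarrow> bool" where
  "linked_into G S I \<longleftrightarrow>
     (\<exists>p. (\<forall>x\<in>I. vpath (p x) G \<and> hd (p x) = x \<and> last (p x) \<in> S) \<and>
          (\<forall>x\<in>I. \<forall>y\<in>I. x \<noteq> y \<longrightarrow> set (p x) \<inter> set (p y) = {}))"

definition linkage_matroid :: "('v, 'a) pre_digraph \<Rightarrow> 'v set \<Rightarrow> 'v set \<Rightarrow> 'v matroid" where
  "linkage_matroid G S E = \<lparr>ground = E, indeps = {I. I \<subseteq> E \<and> linked_into G S I}\<rparr>"

definition gammoid :: "'e matroid \<Rightarrow> bool" where
  "gammoid M \<longleftrightarrow>
     matroid M \<and>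
     (\<exists>(G :: (nat, nat) pre_digraph) S E.
        fin_digraph G \<and> S \<subseteq> verts G \<and> E \<subseteq> verts G \<and> matroid_iso M (linkage_matroid G S E))"

definition binary_gammoid :: "'e matroid \<Rightarrow> bool" where
  "binary_gammoid M \<longleftrightarrow> binary_matroid M \<and> gammoid M"

text \<open>
  The vertices \<open>t, a, b\<close> are \<open>0, 1, 2\<close>; the edges are \<open>0\<close> (between \<open>t\<close> and \<open>a\<close>), \<open>1\<close> (between
  \<open>t\<close> and \<open>b\<close>), and the parallel edges \<open>2\<close> and \<open>3\<close> (between \<open>a\<close> and \<open>b\<close>).
\<close>

definition G\<^sub>8 :: "(nat, nat) multigraph" where
  "G\<^sub>8 =
     \<lparr>gverts = {0, 1, 2},
      gedges = {0, 1, 2, 3},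
      gends = (\<lambda>e. if e = 0 then {0, 1} else if e = 1 then {0, 2} else {1, 2})\<rparr>"

end

theory Submission
  imports Defs
begin

text \<open>
  Work with the cycle space \<open>Z\<close> of a binary matroid. If \<open>B\<close> has no \<open>M(G\<^sub>8)\<close>-minor, then two
  distinct circuits that meet have two elements each, so \<open>B\<close> is a direct sum of loops, coloops,
  circuits and parallel classes. Its es-splittings can then be reduced to a matroid on at most
  three elements by removing loops, coloops, parallel elements and series elements, and gammoids are
  closed under the reverse extensions. Conversely, an \<open>M(G\<^sub>8)\<close>-minor on \<open>{a, b, c, d}\<close> turns
  into an \<open>M(K\<^sub>4)\<close>-minor of the es-splitting for \<open>X = {a, c}\<close> and \<open>e = a\<close>, which violates the
  base orderability of gammoids. Both halves use that gammoids are the restrictions of duals of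
  transversal matroids.
\<close>

section \<open>Binary matroids through their cycle spaces\<close>

text \<open>An es-splitting is given by a matrix, so the question about it is whether it is a
  gammoid. Contracting a series element \<open>f\<close> toggles its partner \<open>g\<close> in
  \<open>X\<close>, so \<open>X\<close> can shrink; the induction therefore carries only
  \<open>e \<in> X\<close>, lets \<open>X\<close> vary, and never removes \<open>e\<close>, the one
  column that \<open>\<gamma>\<close> repeats. In the other direction the exchange takes place in
  the whole es-splitting: an independent set \<open>J\<close> spanning the contracted set is kept
  inside both independent sets that are compared. The choice \<open>X = {a, c}\<close>,
  \<open>e = a\<close> is made so that, modulo \<open>J\<close>, the triples \<open>abc\<close>,
  \<open>cdq\<close>, \<open>a\<gamma>q\<close> and \<open>bd\<gamma>\<close> are cycles; these are
  the four triangles of \<open>K\<^sub>4\<close>.\<close>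

definition cycle_space :: "'a set \<Rightarrow> 'a set set \<Rightarrow> bool" where
  "cycle_space E Z \<longleftrightarrow>
     finite E \<and> Z \<subseteq> Pow E \<and> {} \<in> Z \<and> (\<forall>C\<in>Z. \<forall>D\<in>Z. sym_diff C D \<in> Z)"

definition indep_in :: "'a set set \<Rightarrow> 'a set \<Rightarrow> bool" where
  "indep_in Z I \<longleftrightarrow> (\<forall>D\<in>Z. D \<subseteq> I \<longrightarrow> D = {})"

definition space_matroid :: "'a set \<Rightarrow> 'a set set \<Rightarrow> 'a matroid" where
  "space_matroid E Z = \<lparr>ground = E, indeps = {I. I \<subseteq> E \<and> indep_in Z I}\<rparr>"

lemma cycle_spaceD:
  assumes "cycle_space E Z"
  shows "finite E" "D \<in> Z \<Longrightarrow> D \<subseteq> E" "D \<in> Z \<Longrightarrow> finite D" "{} \<in> Z"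
    "C \<in> Z \<Longrightarrow> D \<in> Z \<Longrightarrow> sym_diff C D \<in> Z"
  using assms unfolding cycle_space_def by (auto intro: finite_subset)

lemma indep_in_mono: "indep_in Z I \<Longrightarrow> J \<subseteq> I \<Longrightarrow> indep_in Z J"
  unfolding indep_in_def by blast

text \<open>Elements of \<open>K\<close> outside \<open>I\<close> are traded one at a time: each
  closes a cycle with \<open>I\<close>, which must pass through it because \<open>I\<close> is
  independent, and adding this cycle replaces the element by elements of \<open>I\<close>.\<close>

lemma congruent_subset_of_spanning:
  assumes Z: "cycle_space E Z" and I: "indep_in Z I"
    and span: "\<And>x. x \<in> K - I \<Longrightarrow> \<not> indep_in Z (insert x I)" and "finite K"
  shows "\<exists>L. L \<subseteq> I \<and> sym_diff K L \<in> Z"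
  using \<open>finite K\<close> span
proof (induction K rule: finite_induct)
  case empty
  then show ?case using cycle_spaceD(4)[OF Z] by (intro exI[of _ "{}"]) auto
next
  case (insert x K)
  then obtain L where L: "L \<subseteq> I" "sym_diff K L \<in> Z" by auto
  show ?case
  proof (cases "x \<in> I")
    case True
    have "sym_diff (insert x K) (sym_diff L {x}) = sym_diff K L" using insert.hyps by auto
    then show ?thesis using L True by (intro exI[of _ "sym_diff L {x}"]) auto
  next
    case False
    then have "\<not> indep_in Z (insert x I)" using insert.prems by auto
    then obtain D where D: "D \<in> Z" "D \<subseteq> insert x I" "D \<noteq> {}" unfolding indep_in_def by blast
    have xD: "x \<in> D" using D I unfolding indep_in_def by blast
    have "sym_diff (sym_diff K L) D = sym_diff (insert x K) (sym_diff L (D - {x}))"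
      using xD False L(1) insert.hyps by blast
    then show ?thesis using cycle_spaceD(5)[OF Z L(2) D(1)] L(1) D(2)
      by (intro exI[of _ "sym_diff L (D - {x})"]) auto
  qed
qed

text \<open>If no element of \<open>J - I\<close> augments \<open>I\<close>, then every subset of \<open>J\<close> is congruent modulo \<open>Z\<close>
  to a subset of \<open>I\<close>, and independence of \<open>J\<close> makes this assignment injective.\<close>

lemma indep_in_augment:
  assumes Z: "cycle_space E Z" and fin: "finite I" "finite J"
    and J: "indep_in Z J" and less: "card I < card J" and I: "indep_in Z I"
  shows "\<exists>x\<in>J - I. indep_in Z (insert x I)"
proof (rule ccontr)
  assume no: "\<not> ?thesis"
  have "\<exists>L. L \<subseteq> I \<and> sym_diff K L \<in> Z" if "K \<subseteq> J" for K
    by (rule congruent_subset_of_spanning[OF Z I]) (use no that finite_subset[OF that fin(2)] in auto)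
  then obtain F where F: "\<And>K. K \<subseteq> J \<Longrightarrow> F K \<subseteq> I \<and> sym_diff K (F K) \<in> Z" by metis
  have "inj_on F (Pow J)"
  proof (rule inj_onI)
    fix K K' assume K: "K \<in> Pow J" "K' \<in> Pow J" "F K = F K'"
    have "sym_diff (sym_diff K (F K)) (sym_diff K' (F K')) \<in> Z"
      using F K cycle_spaceD(5)[OF Z] by blast
    moreover have "sym_diff (sym_diff K (F K)) (sym_diff K' (F K')) = sym_diff K K'"
      using K(3) by blast
    ultimately have "sym_diff K K' = {}" using J K(1,2) unfolding indep_in_def by auto
    then show "K = K'" by blast
  qed
  moreover have "F ` Pow J \<subseteq> Pow I" using F by auto
  ultimately have "card (Pow J) \<le> card (Pow I)" using fin by (simp add: card_inj_on_le)
  then show False using less fin by (simp add: card_Pow)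
qed

lemma matroid_space_matroid:
  assumes "cycle_space E Z"
  shows "matroid (space_matroid E Z)"
proof -
  have "\<exists>x\<in>J - I. insert x I \<subseteq> E \<and> indep_in Z (insert x I)"
    if "I \<subseteq> E" "J \<subseteq> E" "indep_in Z I" "indep_in Z J" "card I < card J" for I J
    using indep_in_augment[OF assms _ _ that(4,5,3)] that(1,2) cycle_spaceD(1)[OF assms]
    by (meson Diff_iff finite_subset insert_subset subset_iff)
  then show ?thesis
    unfolding matroid_def space_matroid_def using cycle_spaceD(1)[OF assms]
    by (auto simp: indep_in_mono) (auto simp: indep_in_def)
qed

text \<open>The kernel of the matrix over GF(2), each vector recorded by its support.\<close>

definition matrix_cycles :: "'e bmatrix \<Rightarrow> 'e set set" where
  "matrix_cycles N = {D. D \<subseteq> cols N \<and> (\<forall>i<nrows N. (\<Sum>x\<in>D. entry N i x) = 0)}"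

lemma sum_sym_diff_bit:
  fixes f :: "'a \<Rightarrow> bit"
  assumes "finite C" "finite D"
  shows "sum f (sym_diff C D) = sum f C + sum f D"
proof -
  have "sum f C = sum f (C - D) + sum f (C \<inter> D)" "sum f D = sum f (D - C) + sum f (C \<inter> D)"
    using assms by (metis Int_commute add.commute sum.Int_Diff)+
  moreover have "sum f (sym_diff C D) = sum f (C - D) + sum f (D - C)"
    using assms by (intro sum.union_disjoint) auto
  moreover have "(b :: bit) + b = 0" for b by (cases b) auto
  ultimately show ?thesis by (metis (no_types, opaque_lifting) add.assoc add.commute add.right_neutral)
qed

lemma cycle_space_matrix_cycles:
  assumes "finite (cols N)"
  shows "cycle_space (cols N) (matrix_cycles N)"
  using assms unfolding cycle_space_def matrix_cycles_def
  by (auto simp: sum_sym_diff_bit finite_subset)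

text \<open>Over GF(2) a coefficient function is the indicator of its support, so the nontrivial
  linear relations on \<open>I\<close> are the nonempty cycles inside \<open>I\<close>.\<close>

lemma vector_matroid_eq_space_matroid:
  assumes "finite (cols N)"
  shows "vector_matroid N = space_matroid (cols N) (matrix_cycles N)"
proof -
  have "(\<forall>c :: 'a \<Rightarrow> bit. (\<forall>i<nrows N. (\<Sum>x\<in>I. c x * entry N i x) = 0) \<longrightarrow> (\<forall>x\<in>I. c x = 0))
      \<longleftrightarrow> indep_in (matrix_cycles N) I" (is "?L \<longleftrightarrow> ?R") if I: "I \<subseteq> cols N" for I
  proof
    assume L: ?L
    show ?R unfolding indep_in_def
    proof (intro ballI impI)
      fix D assume D: "D \<in> matrix_cycles N" "D \<subseteq> I"
      have "(\<Sum>x\<in>I. of_bool (x \<in> D) * entry N i x) = (\<Sum>x\<in>D. entry N i x)" for i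
        using D(2) I assms finite_subset
        by (intro sum.mono_neutral_cong_right) (auto intro: finite_subset)
      then have "\<forall>x\<in>I. (of_bool (x \<in> D) :: bit) = 0"
        using D(1) L[rule_format, of "\<lambda>x. of_bool (x \<in> D)"] by (auto simp: matrix_cycles_def)
      then show "D = {}" using D(2) by auto
    qed
  next
    assume R: ?R
    show ?L
    proof (intro allI impI)
      fix c :: "'a \<Rightarrow> bit"
      assume c: "\<forall>i<nrows N. (\<Sum>x\<in>I. c x * entry N i x) = 0"
      define D where "D = {x\<in>I. c x = 1}"
      have "(\<Sum>x\<in>I. c x * entry N i x) = (\<Sum>x\<in>D. entry N i x)" for i
        using I assms finite_subset unfolding D_def
        by (intro sum.mono_neutral_cong_right) (auto intro: finite_subset)
      then have "D \<in> matrix_cycles N" using c I unfolding matrix_cycles_def D_def by auto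
      then have "D = {}" using R unfolding indep_in_def D_def by auto
      then show "\<forall>x\<in>I. c x = 0" unfolding D_def by auto
    qed
  qed
  then show ?thesis unfolding vector_matroid_def space_matroid_def by auto
qed

definition circuit_of :: "'a set set \<Rightarrow> 'a set \<Rightarrow> bool" where
  "circuit_of Z C \<longleftrightarrow> C \<in> Z \<and> C \<noteq> {} \<and> (\<forall>D\<in>Z. D \<subseteq> C \<longrightarrow> D = {} \<or> D = C)"

text \<open>A cycle through \<open>x\<close> inside \<open>D\<close> of least cardinality works: if
  a nonempty proper subcycle misses \<open>x\<close>, its complement in the cycle is a smaller cycle
  through \<open>x\<close>.\<close>

lemma circuit_through:
  assumes Z: "cycle_space E Z" and "D \<in> Z" "x \<in> D"
  obtains C where "circuit_of Z C" "x \<in> C" "C \<subseteq> D"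
proof -
  define P where "P = (\<lambda>C. C \<in> Z \<and> x \<in> C \<and> C \<subseteq> D)"
  have "P D" using assms unfolding P_def by auto
  then obtain C where C: "P C" and min: "\<And>C'. P C' \<Longrightarrow> card C \<le> card C'"
    using ex_has_least_nat[of P D card] by blast
  have fin: "finite C" using C cycle_spaceD(3)[OF Z] unfolding P_def by auto
  have "C' = {} \<or> C' = C" if C': "C' \<in> Z" "C' \<subseteq> C" for C'
  proof (rule ccontr)
    assume ne: "\<not> ?thesis"
    show False
    proof (cases "x \<in> C'")
      case True
      then have "P C'" using C C' unfolding P_def by auto
      moreover have "card C' < card C" using C' ne fin by (intro psubset_card_mono) auto
      ultimately show False using min by fastforce
    next
      case False
      have "sym_diff C C' = C - C'" using C' by auto
      then have "P (C - C')" using C C' False cycle_spaceD(5)[OF Z, of C C'] unfolding P_def by auto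
      moreover have "card (C - C') < card C" using C' ne fin by (intro psubset_card_mono) auto
      ultimately show False using min by fastforce
    qed
  qed
  then have "circuit_of Z C" using C unfolding circuit_of_def P_def by auto
  then show ?thesis using that C unfolding P_def by auto
qed

section \<open>Gammoids and systems of distinct representatives\<close>

text \<open>Ingleton--Piff duality: gammoids are the restrictions of duals of transversal matroids. The
  map \<open>\<phi>\<close> embeds the ground set into the larger set on which the transversal matroid lives.\<close>

definition avoiding_sdr :: "'j set \<Rightarrow> ('j \<Rightarrow> 'u set) \<Rightarrow> 'u set \<Rightarrow> ('j \<Rightarrow> 'u) \<Rightarrow> bool" where
  "avoiding_sdr J A W s \<longleftrightarrow> inj_on s J \<and> (\<forall>j\<in>J. s j \<in> A j - W)"

text \<open>\<open>ind I\<close> means that the complement of \<open>I\<close> contains a full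
  transversal of the family, which is independence in the dual of a transversal matroid. Elements of
  \<open>U\<close> outside the image of \<open>\<phi>\<close> are those deleted by the
  restriction.\<close>

definition sdr_presented :: "'e set \<Rightarrow> ('e set \<Rightarrow> bool) \<Rightarrow> bool" where
  "sdr_presented E ind \<longleftrightarrow>
     (\<exists>(U :: nat set) (J :: nat set) A \<phi>. finite U \<and> finite J \<and> inj_on \<phi> E \<and> \<phi> ` E \<subseteq> U \<and>
        (\<forall>j\<in>J. A j \<subseteq> U) \<and>
        (\<forall>I. I \<subseteq> E \<longrightarrow> (ind I \<longleftrightarrow> (\<exists>s. avoiding_sdr J A (\<phi> ` I) s))))"

text \<open>A vertex with a successor on a path is represented by that successor, any other vertex
  by itself. Disjointness of the paths makes this injective, and a starting vertex is never a
  successor, so \<open>I\<close> is avoided.\<close>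

lemma linked_into_imp_avoiding_sdr:
  fixes G :: "('v, 'a) pre_digraph"
  assumes link: "linked_into G S I"
  shows "\<exists>s. avoiding_sdr (verts G - S) (\<lambda>v. insert v {w. (v, w) \<in> arcs_ends G \<and> w \<in> verts G}) I s"
proof -
  from link obtain p where p: "\<And>x. x \<in> I \<Longrightarrow> vpath (p x) G \<and> hd (p x) = x \<and> last (p x) \<in> S"
    and dis: "\<And>x y. x \<in> I \<Longrightarrow> y \<in> I \<Longrightarrow> x \<noteq> y \<Longrightarrow> set (p x) \<inter> set (p y) = {}"
    unfolding linked_into_def by metis
  define R where "R v w \<longleftrightarrow> (\<exists>x\<in>I. \<exists>i. Suc i < length (p x) \<and> p x ! i = v \<and> p x ! Suc i = w)" for v w
  have dist: "distinct (p x)" "p x \<noteq> []" "set (p x) \<subseteq> verts G" if "x \<in> I" for x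
    using p[OF that] by (auto simp: vpath_def vwalk_def)
  have same: "x = y" if "x \<in> I" "y \<in> I" "i < length (p x)" "j < length (p y)" "p x ! i = p y ! j"
    for x y i j using dis[OF that(1,2)] that by (metis disjoint_iff nth_mem)
  have arc: "(v, w) \<in> arcs_ends G \<and> w \<in> verts G" if "R v w" for v w
  proof -
    from that obtain x i where x: "x \<in> I" "Suc i < length (p x)" "p x ! i = v" "p x ! Suc i = w"
      unfolding R_def by auto
    have "(q ! i, q ! Suc i) \<in> set (vwalk_arcs q)" if "Suc i < length q" for q :: "'v list" and i
      using that
    proof (induction q arbitrary: i rule: vwalk_arcs.induct)
      case (3 a b xs)
      then show ?case by (cases i) auto
    qed auto
    from this[OF x(2)] show ?thesis
      using p[OF x(1)] x by (auto simp: vpath_def vwalk_def)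
  qed
  have inj: "v = v'" if R: "R v w" "R v' w" for v v' w
  proof -
    obtain x i y j where x: "x \<in> I" "Suc i < length (p x)" "p x ! i = v" "p x ! Suc i = w"
      and y: "y \<in> I" "Suc j < length (p y)" "p y ! j = v'" "p y ! Suc j = w"
      using R unfolding R_def by blast
    have "x = y" using same[OF x(1) y(1) x(2) y(2)] x(4) y(4) by simp
    moreover have "Suc i = Suc j"
      using dist(1)[OF y(1)] x y \<open>x = y\<close> by (metis nth_eq_iff_index_eq)
    ultimately show ?thesis using x y by simp
  qed
  have target: "w \<notin> I" if R: "R v w" for v w
  proof
    assume w: "w \<in> I"
    obtain x i where x: "x \<in> I" "Suc i < length (p x)" "p x ! Suc i = w"
      using R unfolding R_def by blast
    have 0: "p w ! 0 = w" "0 < length (p w)" using p[OF w] dist(2)[OF w] by (simp_all add: hd_conv_nth)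
    have "x = w" using same[OF x(1) w x(2) 0(2)] 0 x by simp
    then show False using dist(1)[OF w] x 0 by (metis nth_eq_iff_index_eq nat.distinct(1))
  qed
  \<comment> \<open>Only the last vertex of a path lacks a successor, and that vertex lies in
    \<open>S\<close>.\<close>
  have on_path: "\<exists>w. R v w" if v: "x \<in> I" "v \<in> set (p x)" "v \<notin> S" for x v
  proof -
    obtain i where i: "i < length (p x)" "p x ! i = v" using v(2) by (metis in_set_conv_nth)
    have "Suc i \<noteq> length (p x)"
    proof
      assume "Suc i = length (p x)"
      then have "last (p x) = v" using i dist(2)[OF v(1)] by (metis diff_Suc_1 last_conv_nth)
      then show False using p[OF v(1)] v(3) by simp
    qed
    then show ?thesis unfolding R_def using i v(1) by (metis Suc_lessI)
  qed
  define s where "s v = (if \<exists>w. R v w then SOME w. R v w else v)" for v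
  have s1: "R v (s v)" if "R v w" for v w using that unfolding s_def by (auto intro: someI)
  have s2: "s v = v" if "\<nexists>w. R v w" for v using that unfolding s_def by auto
  have Rset: "\<exists>x\<in>I. w \<in> set (p x)" if "R v w" for v w using that nth_mem unfolding R_def by blast
  have "inj_on s (verts G - S)"
  proof (rule inj_onI)
    fix v v' assume v: "v \<in> verts G - S" "v' \<in> verts G - S" and eq: "s v = s v'"
    consider "\<exists>w. R v w" "\<exists>w. R v' w" | "\<exists>w. R v w" "\<nexists>w. R v' w" | "\<nexists>w. R v w" "\<exists>w. R v' w"
      | "\<nexists>w. R v w" "\<nexists>w. R v' w" by blast
    then show "v = v'"
    proof cases
      case 1 then show ?thesis using s1 inj eq by metis
    next
      \<comment> \<open>As a successor, \<open>v'\<close> lies on a path; being outside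
        \<open>S\<close>, it would have a successor itself.\<close>
      case 2 then have "R v v'" using s1 s2 eq by metis
      then show ?thesis using Rset on_path 2 v by blast
    next
      case 3 then have "R v' v" using s1 s2 eq by metis
      then show ?thesis using Rset on_path 3 v by blast
    next
      case 4 then show ?thesis using s2 eq by metis
    qed
  qed
  moreover have "s v \<in> insert v {w. (v, w) \<in> arcs_ends G \<and> w \<in> verts G} - I" if v: "v \<in> verts G - S" for v
  proof (cases "\<exists>w. R v w")
    case True
    then have "R v (s v)" using s1 by blast
    then show ?thesis using arc target by blast
  next
    case False
    then have "v \<notin> I" using on_path[of v v] v p[of v] dist(2)[of v] by (metis DiffD2 list.set_sel(1))
    then show ?thesis using s2[OF False] by simp
  qed
  ultimately show ?thesis unfolding avoiding_sdr_def by blast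
qed

text \<open>Conversely, iterating the representatives from a vertex outside their range cannot cycle and
  hence stops in \<open>S\<close>.\<close>

lemma avoiding_sdr_imp_linked_into:
  fixes G :: "('v, 'a) pre_digraph"
  assumes fin: "finite (verts G)" and I: "I \<subseteq> verts G"
    and s: "avoiding_sdr (verts G - S) A I s"
    and A: "\<And>v. v \<in> verts G - S \<Longrightarrow> A v \<subseteq> insert v {w. (v, w) \<in> arcs_ends G \<and> w \<in> verts G}"
  shows "linked_into G S I"
proof -
  have inj: "inj_on s (verts G - S)" and sI: "\<And>v. v \<in> verts G - S \<Longrightarrow> s v \<notin> I"
    and sA: "\<And>v. v \<in> verts G - S \<Longrightarrow> s v = v \<or> ((v, s v) \<in> arcs_ends G \<and> s v \<in> verts G)"
    using s A unfolding avoiding_sdr_def by blast+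
  \<comment> \<open>Injectivity cancels common applications of \<open>s\<close> until one exponent
    is zero. If the other is still positive, \<open>s\<close> takes a value in \<open>I\<close>,
    which it avoids.\<close>
  have iter_inj: "i = j \<and> x = y" if "x \<in> I" "y \<in> I"
    "\<forall>k<i. (s ^^ k) x \<in> verts G - S" "\<forall>k<j. (s ^^ k) y \<in> verts G - S" "(s ^^ i) x = (s ^^ j) y" for x y i j
    using that
  proof (induction i arbitrary: j)
    case 0
    show ?case
    proof (cases j)
      case (Suc j')
      then have "(s ^^ j') y \<in> verts G - S" "s ((s ^^ j') y) = x" using 0 by auto
      then show ?thesis using sI 0 by metis
    qed (use 0 in auto)
  next
    case (Suc i)
    show ?case
    proof (cases j)
      case 0
      then have "(s ^^ i) x \<in> verts G - S" "s ((s ^^ i) x) = y" using Suc by auto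
      then show ?thesis using sI Suc by metis
    next
      case (Suc j')
      have "(s ^^ i) x \<in> verts G - S" "(s ^^ j') y \<in> verts G - S"
        using Suc Suc.prems by auto
      then have "(s ^^ i) x = (s ^^ j') y" using Suc.prems(5) Suc inj by (auto dest: inj_onD)
      then show ?thesis using Suc.IH[of j'] Suc.prems Suc by auto
    qed
  qed
  have stop: "\<exists>n. (s ^^ n) x \<notin> verts G - S" if x: "x \<in> I" for x
  proof (rule ccontr)
    assume "\<not> ?thesis"
    then have all: "\<And>n. (s ^^ n) x \<in> verts G - S" by blast
    then have "inj (\<lambda>n. (s ^^ n) x)" using iter_inj[OF x x] by (auto intro: injI)
    moreover have "range (\<lambda>n. (s ^^ n) x) \<subseteq> verts G" using all by auto
    ultimately show False using fin by (meson finite_imageD finite_subset infinite_UNIV_nat)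
  qed
  define n where "n x = (LEAST n. (s ^^ n) x \<notin> verts G - S)" for x
  have n1: "(s ^^ n x) x \<notin> verts G - S" if "x \<in> I" for x
    using stop[OF that] unfolding n_def by (rule LeastI_ex)
  have n2: "(s ^^ k) x \<in> verts G - S" if "k < n x" for k x
    using that not_less_Least unfolding n_def by blast
  have V: "(s ^^ k) x \<in> verts G" if "k \<le> n x" "x \<in> I" for k x
  proof (cases k)
    case 0 then show ?thesis using I that by auto
  next
    case (Suc k')
    then have "(s ^^ k') x \<in> verts G - S" using n2 that by auto
    then show ?thesis using sA[of "(s ^^ k') x"] Suc by auto
  qed
  \<comment> \<open>There are \<open>Suc (n x)\<close> vertices: the last is the first iterate
    outside \<open>verts G - S\<close>, hence lies in \<open>S\<close>.\<close>
  define p where "p x = map (\<lambda>k. (s ^^ k) x) [0..<Suc (n x)]" for x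
  have arcs: "set (vwalk_arcs (map (\<lambda>k. (s ^^ k) x) [a..<Suc b])) \<subseteq> arcs_ends G"
    if "a \<le> b" "x \<in> I" "b \<le> n x" for a b x
    using that
  proof (induction a rule: inc_induct)
    case base then show ?case by simp
  next
    case (step a)
    have a: "[a..<Suc b] = a # [Suc a..<Suc b]" using step by (simp add: upt_conv_Cons)
    \<comment> \<open>A vertex may represent itself, which gives no arc; before the path stops,
      \<open>iter_inj\<close> excludes such fixed points.\<close>
    have "s ((s ^^ a) x) \<noteq> (s ^^ a) x"
      using iter_inj[of x x "Suc a" a] n2[of _ x] step by (auto simp: less_Suc_eq)
    then have "((s ^^ a) x, s ((s ^^ a) x)) \<in> arcs_ends G" using sA n2[of a x] step by fastforce
    moreover have "hd (map (\<lambda>k. (s ^^ k) x) [Suc a..<Suc b]) = s ((s ^^ a) x)"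
      using step by (simp add: hd_map del: upt_Suc)
    moreover have "map (\<lambda>k. (s ^^ k) x) [Suc a..<Suc b] \<noteq> []" using step by simp
    ultimately show ?case unfolding a using step by (simp del: upt_Suc)
  qed
  have "vpath (p x) G \<and> hd (p x) = x \<and> last (p x) \<in> S" if x: "x \<in> I" for x
  proof -
    have "distinct (p x)" unfolding p_def distinct_map
      using iter_inj[OF x x] n2[of _ x] by (auto intro!: inj_onI simp del: upt_Suc)
    moreover have "vwalk (p x) G"
      using arcs[of 0 "n x" x] x V[of _ x] unfolding vwalk_def p_def by (auto simp del: upt_Suc)
    moreover have "hd (p x) = x" unfolding p_def by (simp add: hd_map del: upt_Suc)
    moreover have "last (p x) = (s ^^ n x) x" unfolding p_def by simp
    ultimately show ?thesis using n1[OF x] V[of "n x" x] x by (auto simp: vpath_def)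
  qed
  moreover have "set (p x) \<inter> set (p y) = {}" if "x \<in> I" "y \<in> I" "x \<noteq> y" for x y
    unfolding p_def using iter_inj[OF that(1,2)] that(3) n2[of _ x] n2[of _ y]
    by (auto simp del: upt_Suc simp: less_Suc_eq_le) (meson less_le_trans)
  ultimately show ?thesis unfolding linked_into_def by blast
qed

lemma gammoid_imp_sdr_presented:
  assumes "gammoid M"
  shows "sdr_presented (ground M) (\<lambda>I. I \<in> indeps M)"
proof -
  obtain G :: "(nat, nat) pre_digraph" and S E where G: "fin_digraph G" "S \<subseteq> verts G" "E \<subseteq> verts G"
    and iso: "matroid_iso M (linkage_matroid G S E)" using assms unfolding gammoid_def by auto
  obtain f where f: "bij_betw f (ground M) E"
    and ind: "\<And>I. I \<subseteq> ground M \<Longrightarrow> I \<in> indeps M \<longleftrightarrow> f ` I \<subseteq> E \<and> linked_into G S (f ` I)"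
    using iso unfolding matroid_iso_def linkage_matroid_def by auto
  let ?A = "\<lambda>v. insert v {w. (v, w) \<in> arcs_ends G \<and> w \<in> verts G}"
  have fE: "f ` ground M = E" using f by (simp add: bij_betw_def)
  have fin: "finite (verts G)" using G(1) by (rule fin_digraph.finite_verts)
  have "I \<in> indeps M \<longleftrightarrow> (\<exists>s. avoiding_sdr (verts G - S) ?A (f ` I) s)" if I: "I \<subseteq> ground M" for I
  proof -
    have sub: "f ` I \<subseteq> E" using I fE by auto
    then have sub': "f ` I \<subseteq> verts G" using G(3) by auto
    have "linked_into G S (f ` I) \<longleftrightarrow> (\<exists>s. avoiding_sdr (verts G - S) ?A (f ` I) s)"
      using linked_into_imp_avoiding_sdr avoiding_sdr_imp_linked_into[OF fin sub', of S ?A] by blast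
    then show ?thesis using ind[OF I] sub by simp
  qed
  then show ?thesis unfolding sdr_presented_def
    using f fE fin G(3)
    by (intro exI[of _ "verts G"] exI[of _ "verts G - S"] exI[of _ ?A] exI[of _ f])
      (auto simp: bij_betw_def)
qed

text \<open>Any representatives \<open>t\<close> of the family identify its index set with the vertices outside \<open>S\<close>.\<close>

lemma sdr_presented_imp_gammoid:
  assumes M: "matroid M" and pres: "sdr_presented (ground M) (\<lambda>I. I \<in> indeps M)"
  shows "gammoid M"
proof -
  obtain U J :: "nat set" and A \<phi> where fin: "finite U" "finite J" and \<phi>: "inj_on \<phi> (ground M)"
    "\<phi> ` ground M \<subseteq> U" and A: "\<And>j. j \<in> J \<Longrightarrow> A j \<subseteq> U"
    and ind: "\<And>I. I \<subseteq> ground M \<Longrightarrow> I \<in> indeps M \<longleftrightarrow> (\<exists>s. avoiding_sdr J A (\<phi> ` I) s)"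
    using pres unfolding sdr_presented_def by (elim exE conjE) metis
  have "{} \<in> indeps M" using M unfolding matroid_def by auto
  then obtain t where t: "inj_on t J" "\<And>j. j \<in> J \<Longrightarrow> t j \<in> A j"
    using ind[of "{}"] unfolding avoiding_sdr_def by auto
  define B where "B v = A (the_inv_into J t v)" for v
  \<comment> \<open>The vertex \<open>t j\<close> sends an arc to each element of
    \<open>A j\<close>, including a loop at itself; pairs are encoded as naturals to serve as
    arcs.\<close>
  define G :: "(nat, nat) pre_digraph" where "G = \<lparr>verts = U,
    arcs = prod_encode ` {(v, w). v \<in> t ` J \<and> w \<in> B v},
    tail = fst \<circ> prod_decode, head = snd \<circ> prod_decode\<rparr>"
  define S where "S = U - t ` J"
  have tU: "t ` J \<subseteq> U" using t A by auto
  have VS: "verts G - S = t ` J" using tU unfolding G_def S_def by auto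
  have ends: "arcs_ends G = {(v, w). v \<in> t ` J \<and> w \<in> B v}"
    unfolding arcs_ends_conv G_def by (auto simp: image_image)
  have B: "B (t j) = A j" if "j \<in> J" for j unfolding B_def using t(1) that by (simp add: the_inv_into_f_f)
  have BU: "B v \<subseteq> U" if "v \<in> t ` J" for v using B A that by auto
  have finar: "finite {(v, w). v \<in> t ` J \<and> w \<in> B v}"
    by (rule finite_subset[of _ "U \<times> U"]) (use tU BU fin in auto)
  have fG: "fin_digraph G"
    using finar fin tU BU by unfold_locales (fastforce simp: G_def)+
  \<comment> \<open>Since \<open>t j \<in> A j\<close>, the vertex already belongs to
    \<open>B v\<close>, so allowing it to represent itself adds nothing.\<close>
  have eq: "insert v {w. (v, w) \<in> arcs_ends G \<and> w \<in> verts G} = B v" if "v \<in> t ` J" for v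
    using that t(2) B BU unfolding ends by (fastforce simp: G_def)
  have key: "linked_into G S W \<longleftrightarrow> (\<exists>s. avoiding_sdr J A W s)" if W: "W \<subseteq> U" for W
  proof
    assume "linked_into G S W"
    from linked_into_imp_avoiding_sdr[OF this] obtain s where
      s: "inj_on s (t ` J)" "\<And>v. v \<in> t ` J \<Longrightarrow> s v \<in> B v - W"
      unfolding avoiding_sdr_def VS using eq by blast
    have "avoiding_sdr J A W (s \<circ> t)" unfolding avoiding_sdr_def
      using s t B by (auto simp: comp_inj_on)
    then show "\<exists>s. avoiding_sdr J A W s" by blast
  next
    assume "\<exists>s. avoiding_sdr J A W s"
    then obtain s where s: "inj_on s J" "\<And>j. j \<in> J \<Longrightarrow> s j \<in> A j - W"
      unfolding avoiding_sdr_def by auto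
    have "inj_on (s \<circ> the_inv_into J t) (t ` J)"
      using s(1) t(1) by (simp add: comp_inj_on inj_on_the_inv_into the_inv_into_onto)
    moreover have "(s \<circ> the_inv_into J t) v \<in> B v - W" if "v \<in> t ` J" for v
      using that s(2) t(1) B by (auto simp: the_inv_into_f_f)
    ultimately have "avoiding_sdr (verts G - S) B W (s \<circ> the_inv_into J t)"
      unfolding avoiding_sdr_def VS by auto
    then show "linked_into G S W"
      by (rule avoiding_sdr_imp_linked_into[rotated 2]) (unfold VS eq, use fin W in \<open>auto simp: G_def\<close>)
  qed
  have "matroid_iso M (linkage_matroid G S (\<phi> ` ground M))"
    unfolding matroid_iso_def
  proof (intro exI[of _ \<phi>] conjI allI impI)
    fix I assume I: "I \<subseteq> ground M"
    then have "\<phi> ` I \<subseteq> U" using \<phi>(2) by auto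
    from key[OF this] ind[OF I] show "I \<in> indeps M \<longleftrightarrow> \<phi> ` I \<in> indeps (linkage_matroid G S (\<phi> ` ground M))"
      using I by (auto simp: linkage_matroid_def)
  qed (use \<phi> in \<open>auto simp: bij_betw_def linkage_matroid_def\<close>)
  moreover have "S \<subseteq> verts G" "\<phi> ` ground M \<subseteq> verts G" using \<phi> unfolding S_def G_def by auto
  ultimately show ?thesis unfolding gammoid_def using M fG by blast
qed

section \<open>One-element extensions of presented independence systems\<close>

lemma avoiding_sdr_antimono: "avoiding_sdr J A W s \<Longrightarrow> W' \<subseteq> W \<Longrightarrow> avoiding_sdr J A W' s"
  unfolding avoiding_sdr_def by blast

lemma avoiding_sdr_Int:
  assumes "\<forall>j\<in>J. A j \<subseteq> U"
  shows "avoiding_sdr J A W s \<longleftrightarrow> avoiding_sdr J A (W \<inter> U) s"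
  using assms unfolding avoiding_sdr_def by blast

text \<open>The new member \<open>k\<close> picks \<open>b\<close> first; for the other members
  \<open>b\<close> is then one more element to avoid.\<close>

lemma avoiding_sdr_insert:
  assumes "k \<notin> J"
  shows "(\<exists>s. avoiding_sdr (insert k J) (A(k := B)) W s) \<longleftrightarrow>
    (\<exists>b\<in>B - W. \<exists>s. avoiding_sdr J A (insert b W) s)" (is "?L \<longleftrightarrow> ?R")
proof
  assume ?L
  then obtain s where s: "avoiding_sdr (insert k J) (A(k := B)) W s" by blast
  then have "avoiding_sdr J A (insert (s k) W) s" "s k \<in> B - W"
    using assms unfolding avoiding_sdr_def by (auto simp: inj_on_def split: if_splits)
  then show ?R by blast
next
  assume ?R
  then obtain b s where b: "b \<in> B - W" "avoiding_sdr J A (insert b W) s" by blast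
  then have "avoiding_sdr (insert k J) (A(k := B)) W (s(k := b))"
    using assms unfolding avoiding_sdr_def inj_on_def by auto
  then show ?L by blast
qed

text \<open>The image of \<open>f\<close> is a fresh \<open>u\<close> in no member of the family, so
  avoiding it costs nothing.\<close>

lemma sdr_presented_coloop:
  assumes pres: "sdr_presented E ind" and f: "f \<notin> E"
    and ind': "\<And>I. I \<subseteq> insert f E \<Longrightarrow> ind' I \<longleftrightarrow> ind (I - {f})"
  shows "sdr_presented (insert f E) ind'"
proof -
  obtain U J :: "nat set" and A \<phi> where fin: "finite U" "finite J" and \<phi>: "inj_on \<phi> E" "\<phi> ` E \<subseteq> U"
    and A: "\<forall>j\<in>J. A j \<subseteq> U"
    and ind: "\<And>I. I \<subseteq> E \<Longrightarrow> ind I \<longleftrightarrow> (\<exists>s. avoiding_sdr J A (\<phi> ` I) s)"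
    using pres unfolding sdr_presented_def by (elim exE conjE) metis
  obtain u where u: "u \<notin> U" using fin(1) ex_new_if_finite infinite_UNIV_nat by blast
  let ?\<phi> = "\<phi>(f := u)"
  have "ind' I \<longleftrightarrow> (\<exists>s. avoiding_sdr J A (?\<phi> ` I) s)" if I: "I \<subseteq> insert f E" for I
  proof -
    have "\<phi> ` (I - {f}) \<subseteq> U" using \<phi>(2) I by auto
    then have "?\<phi> ` I \<inter> U = \<phi> ` (I - {f})" using u by (auto simp: fun_upd_image)
    then show ?thesis using ind'[OF I] ind[of "I - {f}"] I avoiding_sdr_Int[OF A, of "?\<phi> ` I"] by auto
  qed
  moreover have "inj_on ?\<phi> (insert f E)" using \<phi> u f by (auto simp: inj_on_def)
  moreover have "?\<phi> ` insert f E \<subseteq> insert u U" using \<phi> by auto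
  ultimately show ?thesis unfolding sdr_presented_def
    using fin A by (intro exI[of _ "insert u U"] exI[of _ J] exI[of _ A] exI[of _ ?\<phi>]) auto
qed

text \<open>The new member \<open>{u}\<close>, with \<open>u\<close> the image of \<open>f\<close>,
  forces \<open>u\<close> to be used, so \<open>f\<close> can never be avoided.\<close>

lemma sdr_presented_loop:
  assumes pres: "sdr_presented E ind" and f: "f \<notin> E"
    and ind': "\<And>I. I \<subseteq> insert f E \<Longrightarrow> ind' I \<longleftrightarrow> f \<notin> I \<and> ind I"
  shows "sdr_presented (insert f E) ind'"
proof -
  obtain U J :: "nat set" and A \<phi> where fin: "finite U" "finite J" and \<phi>: "inj_on \<phi> E" "\<phi> ` E \<subseteq> U"
    and A: "\<forall>j\<in>J. A j \<subseteq> U"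
    and ind: "\<And>I. I \<subseteq> E \<Longrightarrow> ind I \<longleftrightarrow> (\<exists>s. avoiding_sdr J A (\<phi> ` I) s)"
    using pres unfolding sdr_presented_def by (elim exE conjE) metis
  obtain u where u: "u \<notin> U" using fin(1) ex_new_if_finite infinite_UNIV_nat by blast
  obtain k where k: "k \<notin> J" using fin(2) ex_new_if_finite infinite_UNIV_nat by blast
  let ?\<phi> = "\<phi>(f := u)"
  let ?A = "A(k := {u})"
  have "ind' I \<longleftrightarrow> (\<exists>s. avoiding_sdr (insert k J) ?A (?\<phi> ` I) s)" if I: "I \<subseteq> insert f E" for I
  proof (cases "f \<in> I")
    case True
    then show ?thesis unfolding avoiding_sdr_insert[OF k] using ind'[OF I] by auto
  next
    case False
    then have IE: "I \<subseteq> E" and "\<phi> ` I \<subseteq> U" using \<phi>(2) I by auto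
    then have "insert u (?\<phi> ` I) \<inter> U = \<phi> ` I" "u \<notin> ?\<phi> ` I" using u False by (auto simp: fun_upd_image)
    then show ?thesis unfolding avoiding_sdr_insert[OF k]
      using ind'[OF I] ind[OF IE] False avoiding_sdr_Int[OF A, of "insert u (?\<phi> ` I)"] by auto
  qed
  moreover have "inj_on ?\<phi> (insert f E)" using \<phi> u f by (auto simp: inj_on_def)
  moreover have "?\<phi> ` insert f E \<subseteq> insert u U" using \<phi> by auto
  ultimately show ?thesis unfolding sdr_presented_def using fin A
    by (intro exI[of _ "insert u U"] exI[of _ "insert k J"] exI[of _ ?A] exI[of _ ?\<phi>]) auto
qed

text \<open>The new member \<open>{u, \<phi> g}\<close>, with \<open>u\<close> the image of
  \<open>f\<close>, has no representative if both are avoided. If only \<open>f\<close> is avoided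
  it takes \<open>\<phi> g\<close>, so the old family has to avoid \<open>g\<close> instead; if
  \<open>f\<close> is not avoided it can take \<open>u\<close> and leave the old family
  undisturbed.\<close>

lemma sdr_presented_parallel:
  assumes pres: "sdr_presented E ind" and f: "f \<notin> E" and g: "g \<in> E"
    and ind': "\<And>I. I \<subseteq> insert f E \<Longrightarrow>
      ind' I \<longleftrightarrow> \<not> (f \<in> I \<and> g \<in> I) \<and> ind (if f \<in> I then insert g (I - {f}) else I)"
  shows "sdr_presented (insert f E) ind'"
proof -
  obtain U J :: "nat set" and A \<phi> where fin: "finite U" "finite J" and \<phi>: "inj_on \<phi> E" "\<phi> ` E \<subseteq> U"
    and A: "\<forall>j\<in>J. A j \<subseteq> U"
    and ind: "\<And>I. I \<subseteq> E \<Longrightarrow> ind I \<longleftrightarrow> (\<exists>s. avoiding_sdr J A (\<phi> ` I) s)"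
    using pres unfolding sdr_presented_def by (elim exE conjE) metis
  obtain u where u: "u \<notin> U" using fin(1) ex_new_if_finite infinite_UNIV_nat by blast
  obtain k where k: "k \<notin> J" using fin(2) ex_new_if_finite infinite_UNIV_nat by blast
  have fg: "f \<noteq> g" using f g by auto
  let ?\<phi> = "\<phi>(f := u)"
  let ?A = "A(k := {u, \<phi> g})"
  have inj: "inj_on ?\<phi> (insert f E)" using \<phi> u f by (auto simp: inj_on_def)
  have "ind' I \<longleftrightarrow> (\<exists>s. avoiding_sdr (insert k J) ?A (?\<phi> ` I) s)" if I: "I \<subseteq> insert f E" for I
  proof (cases "f \<in> I")
    case True
    then have uI: "u \<in> ?\<phi> ` I" by auto
    show ?thesis
    proof (cases "g \<in> I")
      case True
      then have "\<phi> g \<in> ?\<phi> ` I" using fg by force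
      then show ?thesis unfolding avoiding_sdr_insert[OF k] using ind'[OF I] True \<open>f \<in> I\<close> uI by auto
    next
      case False
      have gI: "\<phi> g \<notin> ?\<phi> ` I" using False inj_on_image_mem_iff[OF inj, of g I] I g fg by auto
      have IE: "insert g (I - {f}) \<subseteq> E" using I g by auto
      then have "\<phi> ` insert g (I - {f}) \<subseteq> U" using \<phi>(2) by (meson image_mono subset_trans)
      then have "insert (\<phi> g) (?\<phi> ` I) \<inter> U = \<phi> ` insert g (I - {f})"
        using u \<open>f \<in> I\<close> by (auto simp: fun_upd_image)
      then have "(\<exists>s. avoiding_sdr J A (insert (\<phi> g) (?\<phi> ` I)) s) \<longleftrightarrow> ind (insert g (I - {f}))"
        using ind[OF IE] avoiding_sdr_Int[OF A, of "insert (\<phi> g) (?\<phi> ` I)"] by metis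
      moreover have "{u, \<phi> g} - ?\<phi> ` I = {\<phi> g}" using uI gI by (simp add: insert_Diff_if)
      ultimately show ?thesis unfolding avoiding_sdr_insert[OF k]
        using ind'[OF I] \<open>f \<in> I\<close> False by (simp only: bex_simps) simp
    qed
  next
    case False
    then have IE: "I \<subseteq> E" and "\<phi> ` I \<subseteq> U" using \<phi>(2) I by auto
    then have im: "insert u (\<phi> ` I) \<inter> U = \<phi> ` I" "u \<notin> \<phi> ` I" "?\<phi> ` I = \<phi> ` I"
      using u False by (auto simp: fun_upd_image)
    have "(\<exists>b\<in>{u, \<phi> g} - \<phi> ` I. \<exists>s. avoiding_sdr J A (insert b (\<phi> ` I)) s) \<longleftrightarrow>
      (\<exists>s. avoiding_sdr J A (\<phi> ` I) s)"
    proof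
      assume "\<exists>b\<in>{u, \<phi> g} - \<phi> ` I. \<exists>s. avoiding_sdr J A (insert b (\<phi> ` I)) s"
      then show "\<exists>s. avoiding_sdr J A (\<phi> ` I) s" using avoiding_sdr_antimono subset_insertI by metis
    next
      assume "\<exists>s. avoiding_sdr J A (\<phi> ` I) s"
      then have "\<exists>s. avoiding_sdr J A (insert u (\<phi> ` I)) s"
        using avoiding_sdr_Int[OF A, of "insert u (\<phi> ` I)"] im(1) by simp
      then show "\<exists>b\<in>{u, \<phi> g} - \<phi> ` I. \<exists>s. avoiding_sdr J A (insert b (\<phi> ` I)) s" using im(2) by blast
    qed
    then show ?thesis unfolding avoiding_sdr_insert[OF k] im(3)
      using ind'[OF I] ind[OF IE] False by simp
  qed
  moreover have "?\<phi> ` insert f E \<subseteq> insert u U" using \<phi> by auto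
  ultimately show ?thesis unfolding sdr_presented_def using fin A inj g \<phi>(2)
    by (intro exI[of _ "insert u U"] exI[of _ "insert k J"] exI[of _ ?A] exI[of _ ?\<phi>]) auto
qed

text \<open>The old copy of \<open>g\<close> becomes an auxiliary element, represented exactly when both \<open>f\<close> and
  the new \<open>g\<close> have to be avoided.\<close>

lemma sdr_presented_series:
  assumes pres: "sdr_presented E ind" and f: "f \<notin> E" and g: "g \<in> E"
    and ind': "\<And>I. I \<subseteq> insert f E \<Longrightarrow>
      ind' I \<longleftrightarrow> (if f \<in> I \<and> g \<in> I then ind (I - {f}) else ind (I - {f, g}))"
  shows "sdr_presented (insert f E) ind'"
proof -
  obtain U J :: "nat set" and A \<phi> where fin: "finite U" "finite J" and \<phi>: "inj_on \<phi> E" "\<phi> ` E \<subseteq> U"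
    and A: "\<forall>j\<in>J. A j \<subseteq> U"
    and ind: "\<And>I. I \<subseteq> E \<Longrightarrow> ind I \<longleftrightarrow> (\<exists>s. avoiding_sdr J A (\<phi> ` I) s)"
    using pres unfolding sdr_presented_def by (elim exE conjE) metis
  obtain u where u: "u \<notin> U" using fin(1) ex_new_if_finite infinite_UNIV_nat by blast
  have "finite (insert u U)" using fin(1) by simp
  then obtain v where v: "v \<notin> insert u U" using ex_new_if_finite infinite_UNIV_nat by blast
  obtain k where k: "k \<notin> J" using fin(2) ex_new_if_finite infinite_UNIV_nat by blast
  have fg: "f \<noteq> g" using f g by auto
  have \<phi>U: "\<phi> y \<in> U" if "y \<in> E" for y using \<phi>(2) that by auto
  let ?\<phi> = "\<phi>(f := u, g := v)"
  let ?A = "A(k := {u, v, \<phi> g})"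
  have inj: "inj_on ?\<phi> (insert f E)" using \<phi>(1) \<phi>U u v f fg by (auto simp: inj_on_def)
  have "ind' I \<longleftrightarrow> (\<exists>s. avoiding_sdr (insert k J) ?A (?\<phi> ` I) s)" if I: "I \<subseteq> insert f E" for I
  proof -
    have WU: "?\<phi> ` I \<inter> U = \<phi> ` (I - {f, g})"
    proof
      show "?\<phi> ` I \<inter> U \<subseteq> \<phi> ` (I - {f, g})" using u v by auto
      show "\<phi> ` (I - {f, g}) \<subseteq> ?\<phi> ` I \<inter> U" using I \<phi>U by auto
    qed
    have uI: "u \<in> ?\<phi> ` I \<longleftrightarrow> f \<in> I" and vI: "v \<in> ?\<phi> ` I \<longleftrightarrow> g \<in> I"
      using inj_on_image_mem_iff[OF inj, of f I] inj_on_image_mem_iff[OF inj, of g I] I g fg by auto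
    have gW: "\<phi> g \<notin> ?\<phi> ` I" using WU inj_on_image_mem_iff[OF \<phi>(1), of g "I - {f, g}"] \<phi>U[OF g] I g by blast
    have Iu: "insert u (?\<phi> ` I) \<inter> U = \<phi> ` (I - {f, g})" and Iv: "insert v (?\<phi> ` I) \<inter> U = \<phi> ` (I - {f, g})"
      and Ig: "insert (\<phi> g) (?\<phi> ` I) \<inter> U = insert (\<phi> g) (\<phi> ` (I - {f, g}))"
      using WU u v \<phi>U[OF g] by auto
    have eq: "(\<exists>s. avoiding_sdr (insert k J) ?A (?\<phi> ` I) s) \<longleftrightarrow>
      (\<not> (f \<in> I \<and> g \<in> I) \<and> (\<exists>s. avoiding_sdr J A (\<phi> ` (I - {f, g})) s)) \<or>
      (\<exists>s. avoiding_sdr J A (insert (\<phi> g) (\<phi> ` (I - {f, g}))) s)"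
      unfolding avoiding_sdr_insert[OF k]
      using uI vI gW avoiding_sdr_Int[OF A, of "insert u (?\<phi> ` I)"] avoiding_sdr_Int[OF A, of "insert v (?\<phi> ` I)"]
        avoiding_sdr_Int[OF A, of "insert (\<phi> g) (?\<phi> ` I)"] unfolding Iu Iv Ig by blast
    show ?thesis
    proof (cases "f \<in> I \<and> g \<in> I")
      case True
      then have "insert (\<phi> g) (\<phi> ` (I - {f, g})) = \<phi> ` (I - {f})" using fg by auto
      then show ?thesis using eq True ind'[OF I] ind[of "I - {f}"] I by auto
    next
      case False
      have "\<exists>s. avoiding_sdr J A (\<phi> ` (I - {f, g})) s"
        if "\<exists>s. avoiding_sdr J A (insert (\<phi> g) (\<phi> ` (I - {f, g}))) s"
        using that by (blast intro: avoiding_sdr_antimono)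
      moreover have "I - {f, g} \<subseteq> E" using I by auto
      ultimately show ?thesis using eq False ind'[OF I] ind[of "I - {f, g}"] by auto
    qed
  qed
  moreover have "?\<phi> ` insert f E \<subseteq> insert v (insert u U)" using \<phi> by auto
  ultimately show ?thesis unfolding sdr_presented_def using fin A inj \<phi>U[OF g]
    by (intro exI[of _ "insert v (insert u U)"] exI[of _ "insert k J"] exI[of _ ?A] exI[of _ ?\<phi>]) auto
qed

section \<open>Series-parallel extensions in terms of cycle spaces\<close>

abbreviation gammoid_space :: "'a set \<Rightarrow> 'a set set \<Rightarrow> bool" where
  "gammoid_space E Z \<equiv> sdr_presented E (indep_in Z)"

lemma gammoid_space_empty: "gammoid_space {} {{}}"
  unfolding sdr_presented_def indep_in_def avoiding_sdr_def
  by (intro exI[of _ "{}"] exI[of _ "\<lambda>_. {}"] exI[of _ "\<lambda>_. 0"]) auto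

lemma gammoid_space_coloop:
  assumes "gammoid_space E Z" "f \<notin> E" "\<And>D. D \<in> Z \<Longrightarrow> f \<notin> D"
  shows "gammoid_space (insert f E) Z"
  by (rule sdr_presented_coloop[OF assms(1,2)]) (use assms(3) in \<open>auto simp: indep_in_def\<close>)

lemma gammoid_space_loop:
  assumes "gammoid_space E {D\<in>Z. f \<notin> D}" "f \<notin> E" "{f} \<in> Z"
  shows "gammoid_space (insert f E) Z"
  by (rule sdr_presented_loop[OF assms(1,2)]) (use assms(3) in \<open>auto simp: indep_in_def\<close>)

text \<open>Adding the cycle \<open>{f, g}\<close> swaps \<open>f\<close> and \<open>g\<close> in a
  cycle containing just one of them. Hence a set with \<open>f\<close> but not \<open>g\<close> is
  independent exactly if the set with \<open>g\<close> in place of \<open>f\<close> is.\<close>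

lemma gammoid_space_parallel:
  assumes Z: "cycle_space (insert f E) Z" and "gammoid_space E {D\<in>Z. f \<notin> D}"
    "f \<notin> E" "g \<in> E" and fg: "{f, g} \<in> Z"
  shows "gammoid_space (insert f E) Z"
proof (rule sdr_presented_parallel[OF assms(2-4)])
  fix I assume I: "I \<subseteq> insert f E"
  have ne: "f \<noteq> g" using assms by auto
  consider "f \<notin> I" | "f \<in> I" "g \<in> I" | "f \<in> I" "g \<notin> I" by blast
  then show "indep_in Z I \<longleftrightarrow> \<not> (f \<in> I \<and> g \<in> I) \<and>
    indep_in {D\<in>Z. f \<notin> D} (if f \<in> I then insert g (I - {f}) else I)"
  proof cases
    case 1 then show ?thesis by (auto simp: indep_in_def)
  next
    case 2 then show ?thesis using fg unfolding indep_in_def by (metis empty_subsetI insert_not_empty insert_subset)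
  next
    case 3
    have swap: "sym_diff D {f, g} \<in> Z" if "D \<in> Z" for D using cycle_spaceD(5)[OF Z that fg] .
    show ?thesis
    proof
      assume L: "indep_in Z I"
      have "D = {}" if D: "D \<in> Z" "f \<notin> D" "D \<subseteq> insert g (I - {f})" for D
      proof (cases "g \<in> D")
        case True
        have "sym_diff D {f, g} \<subseteq> I" "f \<in> sym_diff D {f, g}" using True D 3 by auto
        then show ?thesis using L swap[OF D(1)] unfolding indep_in_def by blast
      next
        case False
        then have "D \<subseteq> I" using D by auto
        then show ?thesis using L D unfolding indep_in_def by blast
      qed
      then show "\<not> (f \<in> I \<and> g \<in> I) \<and>
        indep_in {D\<in>Z. f \<notin> D} (if f \<in> I then insert g (I - {f}) else I)"
        using 3 by (auto simp: indep_in_def)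
    next
      assume "\<not> (f \<in> I \<and> g \<in> I) \<and>
        indep_in {D\<in>Z. f \<notin> D} (if f \<in> I then insert g (I - {f}) else I)"
      then have R: "\<And>D. D \<in> Z \<Longrightarrow> f \<notin> D \<Longrightarrow> D \<subseteq> insert g (I - {f}) \<Longrightarrow> D = {}"
        using 3 by (auto simp: indep_in_def)
      show "indep_in Z I" unfolding indep_in_def
      proof (intro ballI impI)
        fix D assume D: "D \<in> Z" "D \<subseteq> I"
        show "D = {}"
        proof (cases "f \<in> D")
          case True
          have "sym_diff D {f, g} \<subseteq> insert g (I - {f})" "g \<in> sym_diff D {f, g}" "f \<notin> sym_diff D {f, g}"
            using True D 3 by auto
          then show ?thesis using R[OF swap[OF D(1)]] by blast
        next
          case False
          then show ?thesis using R D by blast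
        qed
      qed
    qed
  qed
qed

text \<open>Every cycle contains both or neither of \<open>f\<close> and \<open>g\<close>. So
  dropping \<open>f\<close> loses no information, and a set that misses one of them contains no
  cycle through the other.\<close>

lemma gammoid_space_series:
  assumes "gammoid_space E ((\<lambda>D. D - {f}) ` Z)" "f \<notin> E" "g \<in> E"
    and fg: "\<And>D. D \<in> Z \<Longrightarrow> f \<in> D \<longleftrightarrow> g \<in> D"
  shows "gammoid_space (insert f E) Z"
proof (rule sdr_presented_series[OF assms(1-3)])
  fix I assume I: "I \<subseteq> insert f E"
  have ne: "f \<noteq> g" using assms by auto
  show "indep_in Z I \<longleftrightarrow> (if f \<in> I \<and> g \<in> I then indep_in ((\<lambda>D. D - {f}) ` Z) (I - {f})
    else indep_in ((\<lambda>D. D - {f}) ` Z) (I - {f, g}))"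
  proof (cases "f \<in> I \<and> g \<in> I")
    case True
    have "(D - {f} \<subseteq> I - {f} \<longrightarrow> D - {f} = {}) \<longleftrightarrow> (D \<subseteq> I \<longrightarrow> D = {})" if "D \<in> Z" for D
      using fg[OF that] True ne by blast
    then show ?thesis using True by (simp add: indep_in_def)
  next
    case False
    have "(D - {f} \<subseteq> I - {f, g} \<longrightarrow> D - {f} = {}) \<longleftrightarrow> (D \<subseteq> I \<longrightarrow> D = {})" if "D \<in> Z" for D
      using fg[OF that] False ne by blast
    then show ?thesis using False unfolding indep_in_def by auto
  qed
qed

section \<open>Base orderability by switching along alternating paths\<close>

text \<open>For each index \<open>P\<close> contains both representatives or neither, so those taken
  from \<open>t\<close> lie inside \<open>P\<close>, those kept from \<open>s\<close> lie outside,
  and the two kinds cannot collide.\<close>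

lemma avoiding_sdr_swap:
  assumes s: "avoiding_sdr J A I s" and t: "avoiding_sdr J A K t"
    and P: "\<And>j. j \<in> J \<Longrightarrow> s j \<in> P \<longleftrightarrow> t j \<in> P"
  shows "avoiding_sdr J A (I - P \<union> K \<inter> P) (\<lambda>j. if t j \<in> P then t j else s j)"
proof -
  have "inj_on (\<lambda>j. if t j \<in> P then t j else s j) J"
  proof (rule inj_onI)
    fix i j assume "i \<in> J" "j \<in> J" "(if t i \<in> P then t i else s i) = (if t j \<in> P then t j else s j)"
    then show "i = j" using s t P unfolding avoiding_sdr_def inj_on_def by metis
  qed
  then show ?thesis using s t P unfolding avoiding_sdr_def by auto
qed

text \<open>Base orderability: the elements of \<open>I\<close> that cannot be added to \<open>K\<close> are exchanged injectively
  with elements of \<open>K\<close>, following the alternating paths of the two systems of representatives.\<close>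

lemma avoiding_sdr_exchange:
  assumes s: "avoiding_sdr J A I s" and t: "avoiding_sdr J A K t"
    and X: "X \<subseteq> I" "\<And>x. x \<in> X \<Longrightarrow> \<nexists>s. avoiding_sdr J A (insert x K) s"
  shows "\<exists>\<pi>. inj_on \<pi> X \<and> (\<forall>x\<in>X. \<pi> x \<in> K - I \<and> (\<exists>s. avoiding_sdr J A (insert (\<pi> x) (I - {x})) s) \<and>
    (\<exists>s. avoiding_sdr J A (insert x (K - {\<pi> x})) s))"
proof -
  \<comment> \<open>An alternating path steps from the \<open>t\<close>-representative of an index
    to its \<open>s\<close>-representative. Elements of \<open>I\<close> have no predecessor and
    elements of \<open>K\<close> no successor, because \<open>s\<close> avoids \<open>I\<close> and
    \<open>t\<close> avoids \<open>K\<close>.\<close>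
  define r where "r u v \<longleftrightarrow> (\<exists>j\<in>J. t j = u \<and> s j = v)" for u v
  have injs: "i = j" if "i \<in> J" "j \<in> J" "s i = s j" for i j using s that unfolding avoiding_sdr_def inj_on_def by blast
  have injt: "i = j" if "i \<in> J" "j \<in> J" "t i = t j" for i j using t that unfolding avoiding_sdr_def inj_on_def by blast
  have sI: "s j \<notin> I" and tK: "t j \<notin> K" if "j \<in> J" for j using s t that unfolding avoiding_sdr_def by auto
  have fwd: "v = w" if "r u v" "r u w" for u v w using that injt unfolding r_def by blast
  have bwd: "u = v" if "r u w" "r v w" for u v w using that injs unfolding r_def by blast
  have into: "v \<notin> I" if "r u v" for u v using that sI unfolding r_def by auto
  have out: "u \<notin> K" if "r u v" for u v using that tK unfolding r_def by auto
  have startI: "x = y" if "r\<^sup>*\<^sup>* x y" "y \<in> I" for x y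
    using that(1) by (cases rule: rtranclp.cases) (use that into in auto)
  have endK: "x = y" if "r\<^sup>*\<^sup>* x y" "x \<in> K" for x y
    using that by (metis converse_rtranclpE out)
  have conf: "r\<^sup>*\<^sup>* y z \<or> r\<^sup>*\<^sup>* z y" if "r\<^sup>*\<^sup>* x y" "r\<^sup>*\<^sup>* x z" for x y z
    using that
  proof (induction rule: rtranclp_induct)
    case (step y w)
    then consider "r\<^sup>*\<^sup>* y z" | "r\<^sup>*\<^sup>* z y" by blast
    then show ?case
    proof cases
      case 1 then show ?thesis using step.hyps(2) fwd by (metis converse_rtranclpE r_into_rtranclp)
    next
      case 2 then show ?thesis using step.hyps(2) by (meson rtranclp.rtrancl_into_rtrancl)
    qed
  qed blast
  have conf': "r\<^sup>*\<^sup>* x y \<or> r\<^sup>*\<^sup>* y x" if "r\<^sup>*\<^sup>* x z" "r\<^sup>*\<^sup>* y z" for x y z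
    using that
  proof (induction rule: converse_rtranclp_induct)
    case (step x w)
    then consider "r\<^sup>*\<^sup>* w y" | "r\<^sup>*\<^sup>* y w" by blast
    then show ?case
    proof cases
      case 1 then show ?thesis using step.hyps(1) by (meson converse_rtranclp_into_rtranclp)
    next
      case 2 then show ?thesis using step.hyps(1) bwd by (metis rtranclp.cases r_into_rtranclp)
    qed
  qed blast
  define P where "P x = {y. r\<^sup>*\<^sup>* x y}" for x
  \<comment> \<open>The forward orbit of \<open>x\<close> is also closed backwards, since
    predecessors are unique and \<open>x \<in> I\<close> has none; this is what
    \<open>avoiding_sdr_swap\<close> requires.\<close>
  have P: "s j \<in> P x \<longleftrightarrow> t j \<in> P x" if x: "x \<in> I" and j: "j \<in> J" for x j
  proof
    assume "t j \<in> P x"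
    moreover have "r (t j) (s j)" using j unfolding r_def by blast
    ultimately show "s j \<in> P x" unfolding P_def by (simp add: rtranclp.rtrancl_into_rtrancl)
  next
    assume "s j \<in> P x"
    then have "r\<^sup>*\<^sup>* x (s j)" unfolding P_def by simp
    then obtain u where "r\<^sup>*\<^sup>* x u" "r u (s j)" using sI[OF j] x by (metis rtranclp.cases)
    moreover have "r (t j) (s j)" using j unfolding r_def by blast
    ultimately show "t j \<in> P x" using bwd unfolding P_def by blast
  qed
  have PI: "I \<inter> P x = {x}" if "x \<in> I" for x using that startI unfolding P_def by blast
  \<comment> \<open>If the path from \<open>x\<close> missed \<open>K\<close>, switching along it
    would yield representatives avoiding \<open>insert x K\<close>, against the assumption on
    \<open>X\<close>.\<close>
  have "\<exists>y. y \<in> K \<inter> P x" if x: "x \<in> X" for x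
  proof (rule ccontr)
    assume no: "\<nexists>y. y \<in> K \<inter> P x"
    have xI: "x \<in> I" using x X by auto
    have "K - P x \<union> I \<inter> P x = insert x K" using PI[OF xI] no by auto
    then show False using avoiding_sdr_swap[OF t s, of "P x"] P[OF xI] X(2)[OF x] by metis
  qed
  then obtain \<pi> where \<pi>: "\<And>x. x \<in> X \<Longrightarrow> \<pi> x \<in> K \<inter> P x" by metis
  have KP: "K \<inter> P x = {\<pi> x}" if x: "x \<in> X" for x
    using \<pi>[OF x] conf endK unfolding P_def by blast
  have "avoiding_sdr J A (insert (\<pi> x) (I - {x})) (\<lambda>j. if t j \<in> P x then t j else s j)"
    "avoiding_sdr J A (insert x (K - {\<pi> x})) (\<lambda>j. if s j \<in> P x then s j else t j)" if x: "x \<in> X" for x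
  proof -
    have xI: "x \<in> I" using x X by auto
    have "I - P x \<union> K \<inter> P x = insert (\<pi> x) (I - {x})" using PI[OF xI] KP[OF x] by auto
    then show "avoiding_sdr J A (insert (\<pi> x) (I - {x})) (\<lambda>j. if t j \<in> P x then t j else s j)"
      using avoiding_sdr_swap[OF s t, of "P x"] P[OF xI] by metis
    have "K - P x \<union> I \<inter> P x = insert x (K - {\<pi> x})" using PI[OF xI] KP[OF x] by auto
    then show "avoiding_sdr J A (insert x (K - {\<pi> x})) (\<lambda>j. if s j \<in> P x then s j else t j)"
      using avoiding_sdr_swap[OF t s, of "P x"] P[OF xI] by metis
  qed
  moreover have "inj_on \<pi> X"
  proof (rule inj_onI)
    fix x y assume xy: "x \<in> X" "y \<in> X" "\<pi> x = \<pi> y"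
    then have "r\<^sup>*\<^sup>* x (\<pi> x)" "r\<^sup>*\<^sup>* y (\<pi> x)" using \<pi>[OF xy(1)] \<pi>[OF xy(2)] unfolding P_def by simp_all
    \<comment> \<open>Of two paths with a common end one start reaches the other, and a start in
      \<open>I\<close> has no predecessor.\<close>
    then show "x = y" using conf' startI xy X(1) by blast
  qed
  moreover have "\<pi> x \<in> K - I" if x: "x \<in> X" for x
  proof -
    have "x \<notin> K" using X(2)[OF x] t by (metis insert_absorb)
    moreover have "I \<inter> P x = {x}" using PI x X(1) by blast
    ultimately show ?thesis using \<pi>[OF x] by (metis DiffI IntD1 IntD2 IntI singletonD)
  qed
  ultimately show ?thesis by blast
qed

section \<open>The cycle space of the es-splitting\<close>

definition es_ground :: "'a set \<Rightarrow> 'a option option set" where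
  "es_ground E = insert None (Some ` insert None (Some ` E))"

text \<open>The set of old elements obtained by replacing \<open>\<gamma>\<close> with \<open>e\<close> and dropping \<open>q\<close>, modulo 2.\<close>

definition es_base :: "'a \<Rightarrow> 'a option option set \<Rightarrow> 'a set" where
  "es_base e D = sym_diff {y. Some (Some y) \<in> D} (if Some None \<in> D then {e} else {})"

text \<open>The old rows see \<open>\<gamma>\<close> as a second \<open>e\<close>, which gives the
  condition on \<open>es_base\<close>. The new row has ones at \<open>X\<close> and at
  \<open>q\<close> but a zero at \<open>\<gamma>\<close>, so \<open>q\<close> corrects the parity
  and \<open>\<gamma>\<close> is not counted.\<close>

definition es_cycles :: "'a set \<Rightarrow> 'a set set \<Rightarrow> 'a set \<Rightarrow> 'a \<Rightarrow> 'a option option set set" where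
  "es_cycles E Z X e = {D. D \<subseteq> es_ground E \<and> es_base e D \<in> Z \<and>
     (None \<in> D \<longleftrightarrow> odd (card {y\<in>X. Some (Some y) \<in> D}))}"

lemma finite_old_elements:
  assumes "finite E" "D \<subseteq> es_ground E"
  shows "finite {y. Some (Some y) \<in> D}"
proof (rule finite_subset[OF _ assms(1)])
  show "{y. Some (Some y) \<in> D} \<subseteq> E" using assms(2) unfolding es_ground_def by auto
qed

lemma odd_card_sym_diff:
  assumes "finite A" "finite B"
  shows "odd (card (sym_diff A B)) \<longleftrightarrow> odd (card A) \<noteq> odd (card B)"
proof -
  have "card A = card (A - B) + card (A \<inter> B)" "card B = card (B - A) + card (A \<inter> B)"
    using assms by (metis Int_commute add.commute card_Diff_subset_Int card_mono finite_Int inf_le1 le_add_diff_inverse)+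
  moreover have "card (sym_diff A B) = card (A - B) + card (B - A)"
    using assms by (intro card_Un_disjoint) auto
  ultimately show ?thesis by simp blast
qed

lemma cycle_space_es_cycles:
  assumes Z: "cycle_space E Z"
  shows "cycle_space (es_ground E) (es_cycles E Z X e)"
proof -
  note fin = cycle_spaceD(1)[OF Z]
  have "sym_diff C D \<in> es_cycles E Z X e" if C: "C \<in> es_cycles E Z X e" and D: "D \<in> es_cycles E Z X e" for C D
  proof -
    have CD: "C \<subseteq> es_ground E" "D \<subseteq> es_ground E" using C D unfolding es_cycles_def by auto
    have "es_base e (sym_diff C D) = sym_diff (es_base e C) (es_base e D)"
      unfolding es_base_def by auto
    then have "es_base e (sym_diff C D) \<in> Z" using C D cycle_spaceD(5)[OF Z] unfolding es_cycles_def by auto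
    moreover have "{y\<in>X. Some (Some y) \<in> sym_diff C D} =
      sym_diff {y\<in>X. Some (Some y) \<in> C} {y\<in>X. Some (Some y) \<in> D}" by auto
    moreover have "finite {y\<in>X. Some (Some y) \<in> C}" "finite {y\<in>X. Some (Some y) \<in> D}"
      using finite_old_elements[OF fin CD(1)] finite_old_elements[OF fin CD(2)]
      by (auto elim: rev_finite_subset)
    ultimately show ?thesis using C D CD unfolding es_cycles_def by (auto simp: odd_card_sym_diff)
  qed
  moreover have "finite (es_ground E)" using fin unfolding es_ground_def by simp
  moreover have "{} \<in> es_cycles E Z X e" using cycle_spaceD(4)[OF Z] unfolding es_cycles_def es_base_def by auto
  ultimately show ?thesis unfolding cycle_space_def es_cycles_def by blast
qed

lemma sum_es_ground:
  fixes h :: "'a option option \<Rightarrow> 'b::comm_monoid_add"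
  assumes "finite E" "D \<subseteq> es_ground E"
  shows "sum h D = (\<Sum>y | Some (Some y) \<in> D. h (Some (Some y))) +
    ((if Some None \<in> D then h (Some None) else 0) + (if None \<in> D then h None else 0))"
proof -
  let ?Y = "{y. Some (Some y) \<in> D}"
  let ?g = "if Some None \<in> D then {Some None} else {} :: 'a option option set"
  let ?q = "if None \<in> D then {None} else {} :: 'a option option set"
  have fin: "finite ?Y" by (rule finite_old_elements[OF assms])
  have "D = (\<lambda>y. Some (Some y)) ` ?Y \<union> (?g \<union> ?q)"
  proof (intro equalityI subsetI)
    fix x assume "x \<in> D"
    then show "x \<in> (\<lambda>y. Some (Some y)) ` ?Y \<union> (?g \<union> ?q)"
      by (cases x; cases "the x") auto
  qed (auto split: if_splits)
  then have "sum h D = sum h ((\<lambda>y. Some (Some y)) ` ?Y \<union> (?g \<union> ?q))" by simp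
  also have "\<dots> = sum h ((\<lambda>y. Some (Some y)) ` ?Y) + (sum h ?g + sum h ?q)"
    using fin by (subst sum.union_disjoint; auto simp: add.commute)
  also have "sum h ((\<lambda>y. Some (Some y)) ` ?Y) = (\<Sum>y\<in>?Y. h (Some (Some y)))"
    by (subst sum.reindex) (auto simp: inj_on_def)
  finally show ?thesis by simp
qed

lemma sum_indicator_bit:
  assumes "finite Y"
  shows "(\<Sum>y\<in>Y. (if y \<in> X then 1 else 0 :: bit)) = of_bool (odd (card {y\<in>X. y \<in> Y}))"
  using assms
proof (induction Y rule: finite_induct)
  case (insert x Y)
  show ?case
  proof (cases "x \<in> X")
    case True
    then have "{y\<in>X. y \<in> insert x Y} = insert x {y\<in>X. y \<in> Y}" by auto
    then show ?thesis using insert True by simp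
  next
    case False
    then have "{y\<in>X. y \<in> insert x Y} = {y\<in>X. y \<in> Y}" by auto
    then show ?thesis using insert False by simp
  qed
qed simp

lemma es_splitting_eq_space_matroid:
  assumes fin: "finite (cols A)" and e: "e \<in> cols A"
  shows "es_splitting A X e = space_matroid (es_ground (cols A)) (es_cycles (cols A) (matrix_cycles A) X e)"
proof -
  let ?N = "element_splitting_matrix (add_parallel_column A e) (Some ` X)"
  have cols: "cols ?N = es_ground (cols A)"
    unfolding element_splitting_matrix_def add_parallel_column_def es_ground_def by simp
  have rows: "nrows ?N = Suc (nrows A)"
    unfolding element_splitting_matrix_def add_parallel_column_def by simp
  have ent: "entry ?N i (Some (Some y)) = (if i = nrows A then (if y \<in> X then 1 else 0) else entry A i y)"
    "entry ?N i (Some None) = (if i = nrows A then 0 else entry A i e)"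
    "entry ?N i None = (if i = nrows A then 1 else 0)" for i y
    unfolding element_splitting_matrix_def add_parallel_column_def by auto
  have "D \<in> matrix_cycles ?N \<longleftrightarrow> D \<in> es_cycles (cols A) (matrix_cycles A) X e"
    if D: "D \<subseteq> es_ground (cols A)" for D
  proof -
    let ?Y = "{y. Some (Some y) \<in> D}"
    have finY: "finite ?Y" by (rule finite_old_elements[OF fin D])
    have old: "(\<Sum>x\<in>D. entry ?N i x) = (\<Sum>y\<in>es_base e D. entry A i y)" if "i < nrows A" for i
      unfolding sum_es_ground[OF fin D] ent es_base_def using that finY
      by (subst sum_sym_diff_bit) auto
    have "(\<Sum>x\<in>D. entry ?N (nrows A) x) =
      of_bool (odd (card {y\<in>X. y \<in> ?Y})) + of_bool (None \<in> D)"
      unfolding sum_es_ground[OF fin D] ent using sum_indicator_bit[OF finY, of X] by simp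
    also have "\<dots> = 0 \<longleftrightarrow> (None \<in> D \<longleftrightarrow> odd (card {y\<in>X. Some (Some y) \<in> D}))" by auto
    finally have new: "(\<Sum>x\<in>D. entry ?N (nrows A) x) = 0 \<longleftrightarrow>
      (None \<in> D \<longleftrightarrow> odd (card {y\<in>X. Some (Some y) \<in> D}))" .
    have base: "es_base e D \<subseteq> cols A" using D e unfolding es_base_def es_ground_def by auto
    show ?thesis unfolding matrix_cycles_def es_cycles_def cols rows
      using D base new old by (auto simp: less_Suc_eq all_conj_distrib)
  qed
  moreover have "D \<subseteq> es_ground (cols A)" if "D \<in> matrix_cycles ?N" for D
    using that unfolding matrix_cycles_def cols by auto
  moreover have "D \<subseteq> es_ground (cols A)" if "D \<in> es_cycles (cols A) (matrix_cycles A) X e" for D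
    using that unfolding es_cycles_def by auto
  ultimately have "matrix_cycles ?N = es_cycles (cols A) (matrix_cycles A) X e" by blast
  moreover have "finite (cols ?N)" unfolding cols es_ground_def using fin by simp
  ultimately show ?thesis unfolding es_splitting_def element_splitting_def
    by (simp add: vector_matroid_eq_space_matroid cols)
qed

text \<open>Only \<open>e\<close> can enter or leave \<open>es_base\<close> through
  \<open>\<gamma>\<close>; as \<open>f \<noteq> e\<close>, missing \<open>f\<close> means the same
  for \<open>D\<close> and for \<open>es_base e D\<close>.\<close>

lemma es_cycles_delete:
  assumes "f \<notin> E" "f \<noteq> e"
  shows "{D \<in> es_cycles (insert f E) Z X e. Some (Some f) \<notin> D} = es_cycles E {D\<in>Z. f \<notin> D} X e"
proof -
  have "D \<subseteq> es_ground (insert f E) \<and> Some (Some f) \<notin> D \<longleftrightarrow> D \<subseteq> es_ground E \<and> f \<notin> es_base e D" for D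
    using assms unfolding es_ground_def es_base_def by auto
  then show ?thesis unfolding es_cycles_def by blast
qed

text \<open>A contracted series element \<open>f\<close> of \<open>X\<close> is compensated by toggling the membership of its
  series partner \<open>g\<close> in \<open>X\<close>.\<close>

lemma es_cycles_contract:
  assumes Z: "cycle_space (insert f E) Z" and f: "f \<notin> E" "f \<noteq> e" and g: "g \<in> E" "g \<noteq> e"
    and series: "\<And>D. D \<in> Z \<Longrightarrow> f \<in> D \<longleftrightarrow> g \<in> D"
  shows "(\<lambda>D. D - {Some (Some f)}) ` es_cycles (insert f E) Z X e =
    es_cycles E ((\<lambda>D. D - {f}) ` Z) (if f \<in> X then sym_diff X {g} else X) e"
proof -
  let ?X = "if f \<in> X then sym_diff X {g} else X"
  let ?f = "Some (Some f)" and ?g = "Some (Some g)"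
  have fg: "f \<noteq> g" using f g by auto
  have fin: "finite (insert f E)" using cycle_spaceD(1)[OF Z] .
  have main: "D \<in> es_cycles (insert f E) Z X e \<longleftrightarrow>
      D - {?f} \<in> es_cycles E ((\<lambda>D. D - {f}) ` Z) ?X e"
    if D: "D \<subseteq> es_ground (insert f E)" and Dfg: "?f \<in> D \<longleftrightarrow> ?g \<in> D" for D
  proof -
    have b: "es_base e (D - {?f}) = es_base e D - {f}" using f(2) unfolding es_base_def by auto
    have bfg: "f \<in> es_base e D \<longleftrightarrow> g \<in> es_base e D" using Dfg f g unfolding es_base_def by auto
    have "es_base e D \<in> Z" if "es_base e D - {f} = B - {f}" "B \<in> Z" for B
    proof -
      have "f \<in> es_base e D \<longleftrightarrow> f \<in> B" using series[OF that(2)] bfg that(1) fg by blast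
      then have "es_base e D = B" using that(1) by blast
      then show ?thesis using that(2) by simp
    qed
    then have Zeq: "es_base e (D - {?f}) \<in> (\<lambda>D. D - {f}) ` Z \<longleftrightarrow> es_base e D \<in> Z"
      unfolding b by blast
    have gr: "D - {?f} \<subseteq> es_ground E" using D unfolding es_ground_def by auto
    have "finite {y. Some (Some y) \<in> D}" by (rule finite_old_elements[OF fin D])
    then have finS: "finite {y\<in>X. Some (Some y) \<in> D}" by (rule rev_finite_subset) auto
    have "odd (card {y\<in>?X. Some (Some y) \<in> D - {?f}}) \<longleftrightarrow> odd (card {y\<in>X. Some (Some y) \<in> D})"
    proof (cases "f \<in> X \<and> ?f \<in> D")
      case True
      \<comment> \<open>Dropping \<open>f\<close> and toggling \<open>g\<close> changes the counted
        set by the two elements \<open>f\<close> and \<open>g\<close>, which preserves its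
        parity.\<close>
      then have "{y\<in>?X. Some (Some y) \<in> D - {?f}} = sym_diff {y\<in>X. Some (Some y) \<in> D} {f, g}"
        using Dfg fg by auto
      then show ?thesis using odd_card_sym_diff[OF finS, of "{f, g}"] fg by simp
    next
      case False
      then have "{y\<in>?X. Some (Some y) \<in> D - {?f}} = {y\<in>X. Some (Some y) \<in> D}"
        using Dfg fg by auto
      then show ?thesis by simp
    qed
    then show ?thesis using D gr Zeq unfolding es_cycles_def by simp
  qed
  show ?thesis
  proof (intro equalityI subsetI)
    fix D' assume "D' \<in> (\<lambda>D. D - {?f}) ` es_cycles (insert f E) Z X e"
    then obtain D where D: "D' = D - {?f}" "D \<in> es_cycles (insert f E) Z X e" by blast
    have "D \<subseteq> es_ground (insert f E)" "es_base e D \<in> Z" using D(2) unfolding es_cycles_def by auto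
    moreover from this have "?f \<in> D \<longleftrightarrow> ?g \<in> D" using series[of "es_base e D"] f g
      unfolding es_base_def by (auto split: if_splits)
    ultimately show "D' \<in> es_cycles E ((\<lambda>D. D - {f}) ` Z) ?X e" using main D by blast
  next
    fix D' assume D': "D' \<in> es_cycles E ((\<lambda>D. D - {f}) ` Z) ?X e"
    then have gr: "D' \<subseteq> es_ground E" unfolding es_cycles_def by auto
    then have nf: "?f \<notin> D'" using f(1) unfolding es_ground_def by auto
    \<comment> \<open>The element \<open>f\<close> has to return exactly when its series partner is
      present.\<close>
    define D where "D = (if ?g \<in> D' then insert ?f D' else D')"
    have D: "D - {?f} = D'" "?f \<in> D \<longleftrightarrow> ?g \<in> D" using nf fg unfolding D_def by auto
    have "D \<subseteq> es_ground (insert f E)" using gr unfolding D_def es_ground_def by auto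
    then have "D \<in> es_cycles (insert f E) Z X e" using main[of D] D D' by simp
    then show "D' \<in> (\<lambda>D. D - {?f}) ` es_cycles (insert f E) Z X e" using D(1) by blast
  qed
qed

section \<open>Theta-free matroids have series-parallel es-splittings\<close>

text \<open>The condition is symmetric in \<open>C\<close> and \<open>D\<close>, so both have two
  elements: the only thetas left consist of three parallel elements.\<close>

definition theta_free :: "'a set set \<Rightarrow> bool" where
  "theta_free Z \<longleftrightarrow>
     (\<forall>C D. circuit_of Z C \<and> circuit_of Z D \<and> C \<noteq> D \<and> C \<inter> D \<noteq> {} \<longrightarrow> card C = 2)"

lemma theta_freeD:
  "theta_free Z \<Longrightarrow> circuit_of Z C \<Longrightarrow> circuit_of Z D \<Longrightarrow> x \<in> C \<Longrightarrow> x \<in> D \<Longrightarrow> C \<noteq> D \<Longrightarrow> card C = 2"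
  unfolding theta_free_def by blast

lemma cycle_space_delete:
  assumes "cycle_space (insert f E) Z"
  shows "cycle_space E {D\<in>Z. f \<notin> D}"
  using assms unfolding cycle_space_def by auto

lemma theta_free_delete:
  assumes "theta_free Z"
  shows "theta_free {D\<in>Z. f \<notin> D}"
proof -
  have "circuit_of Z C" if "circuit_of {D\<in>Z. f \<notin> D} C" for C
    using that unfolding circuit_of_def by blast
  then show ?thesis using assms unfolding theta_free_def by blast
qed

lemma cycle_space_contract:
  assumes Z: "cycle_space (insert f E) Z" and f: "f \<notin> E"
  shows "cycle_space E ((\<lambda>D. D - {f}) ` Z)"
proof -
  have "sym_diff (C - {f}) (D - {f}) = sym_diff C D - {f}" for C D by auto
  then have "\<forall>C\<in>(\<lambda>D. D - {f}) ` Z. \<forall>D\<in>(\<lambda>D. D - {f}) ` Z. sym_diff C D \<in> (\<lambda>D. D - {f}) ` Z"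
    using cycle_spaceD(5)[OF Z] by (smt (verit) image_iff)
  moreover have "(\<lambda>D. D - {f}) ` Z \<subseteq> Pow E" using cycle_spaceD(2)[OF Z] by auto
  moreover have "{} \<in> (\<lambda>D. D - {f}) ` Z" using cycle_spaceD(4)[OF Z] by force
  ultimately show ?thesis using cycle_spaceD(1)[OF Z] unfolding cycle_space_def by simp
qed

text \<open>Circuits of the contraction lift, since \<open>f\<close> follows \<open>g\<close>. The
  danger is that a two-element circuit through \<open>f\<close> loses an element. It would be
  \<open>{f, g}\<close>; the other circuit meets it in \<open>g\<close>, so it contains
  \<open>f\<close> as well and is the same set.\<close>

lemma theta_free_contract:
  assumes Z: "theta_free Z" and fg: "f \<noteq> g" and series: "\<And>D. D \<in> Z \<Longrightarrow> f \<in> D \<longleftrightarrow> g \<in> D"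
  shows "theta_free ((\<lambda>D. D - {f}) ` Z)"
proof -
  let ?Z = "(\<lambda>D. D - {f}) ` Z"
  have lift: "\<exists>C. circuit_of Z C \<and> C' = C - {f}" if C': "circuit_of ?Z C'" for C'
  proof -
    obtain C where C: "C \<in> Z" "C' = C - {f}" using C' unfolding circuit_of_def by blast
    have "D = {} \<or> D = C" if D: "D \<in> Z" "D \<subseteq> C" for D
    proof -
      have "D - {f} \<in> ?Z" "D - {f} \<subseteq> C'" using D C by auto
      then have "D - {f} = {} \<or> D - {f} = C - {f}" using C' C(2) unfolding circuit_of_def by blast
      then show ?thesis using series[OF D(1)] series[OF C(1)] fg by blast
    qed
    moreover have "C \<noteq> {}" using C' C unfolding circuit_of_def by auto
    ultimately show ?thesis using C unfolding circuit_of_def by blast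
  qed
  show ?thesis unfolding theta_free_def
  proof (intro allI impI, elim conjE)
    fix C' D' assume "circuit_of ?Z C'" "circuit_of ?Z D'" and ne: "C' \<noteq> D'" and int: "C' \<inter> D' \<noteq> {}"
    then obtain C D where C: "circuit_of Z C" "C' = C - {f}" and D: "circuit_of Z D" "D' = D - {f}"
      using lift by meson
    obtain x where x: "x \<in> C" "x \<in> D" "x \<noteq> f" using int C(2) D(2) by blast
    have cards: "card C = 2" "card D = 2"
      using theta_freeD[OF Z C(1) D(1) x(1,2)] theta_freeD[OF Z D(1) C(1) x(2,1)] ne C(2) D(2) by blast+
    have eq: "B = {f, g}" if "circuit_of Z B" "card B = 2" "f \<in> B" for B
    proof -
      have "{f, g} \<subseteq> B" using that series[of B] unfolding circuit_of_def by auto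
      then show ?thesis using that(2) fg by (metis card_2_iff card_seteq card_2_iff finite.emptyI finite.insertI order_refl)
    qed
    have "f \<notin> C"
    proof
      assume "f \<in> C"
      then have "C = {f, g}" using eq C(1) cards(1) by blast
      then have "f \<in> D" using x series[of D] D(1) unfolding circuit_of_def by auto
      then have "D = {f, g}" using eq D(1) cards(2) by blast
      then show False using \<open>C = {f, g}\<close> ne C(2) D(2) by simp
    qed
    then show "card C' = 2" using C(2) cards(1) by simp
  qed
qed

text \<open>Two circuits through \<open>f\<close> have two elements each and give parallel partners.
  If there is only one circuit \<open>C\<close>, every cycle through \<open>f\<close> contains
  \<open>C\<close>, so the rest of \<open>C\<close> is in series with \<open>f\<close>. Partners
  equal to \<open>e\<close> are separated because \<open>\<gamma>\<close> copies \<open>e\<close>;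
  \<open>triple\<close> supplies two partners for a later pigeonhole argument on membership in
  \<open>X\<close>.\<close>

lemma theta_free_cases [consumes 3, case_names coloop loop parallel_e triple series]:
  assumes Z: "cycle_space E Z" and tf: "theta_free Z" and f: "f \<noteq> e"
  obtains (coloop) "\<And>D. D \<in> Z \<Longrightarrow> f \<notin> D"
    | (loop) "{f} \<in> Z"
    | (parallel_e) "{f, e} \<in> Z"
    | (triple) g h where "{f, g} \<in> Z" "{f, h} \<in> Z" "f \<noteq> g" "f \<noteq> h" "g \<noteq> h" "g \<noteq> e" "h \<noteq> e"
    | (series) g where "g \<in> E" "g \<noteq> f" "g \<noteq> e" "\<And>D. D \<in> Z \<Longrightarrow> f \<in> D \<longleftrightarrow> g \<in> D"
proof (cases "\<exists>D\<in>Z. f \<in> D")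
  case False
  then show ?thesis using coloop by blast
next
  case True
  then obtain C where C: "circuit_of Z C" "f \<in> C" using circuit_through[OF Z] by metis
  have CZ: "C \<in> Z" using C(1) unfolding circuit_of_def by auto
  show ?thesis
  proof (cases "\<exists>D. circuit_of Z D \<and> f \<in> D \<and> D \<noteq> C")
    case True
    then obtain D where D: "circuit_of Z D" "f \<in> D" "D \<noteq> C" by blast
    have DZ: "D \<in> Z" using D(1) unfolding circuit_of_def by auto
    have "card C = 2" "card D = 2"
      using theta_freeD[OF tf C(1) D(1) C(2) D(2)] theta_freeD[OF tf D(1) C(1) D(2) C(2)] D(3) by auto
    then obtain g h where "C = {f, g}" "D = {f, h}" "f \<noteq> g" "f \<noteq> h"
      using C(2) D(2) unfolding card_2_iff by (metis doubleton_eq_iff insertE singletonD)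
    then show ?thesis using triple[of g h] parallel_e CZ DZ D(3) by (cases "g = e"; cases "h = e") auto
  next
    case False
    have sub: "C \<subseteq> D" if D: "D \<in> Z" "f \<in> D" for D
      using circuit_through[OF Z D] False by metis
    consider "C = {f}" | "C = {f, e}" | g where "g \<in> C" "g \<noteq> f" "g \<noteq> e" using C(2) by blast
    then show ?thesis
    proof cases
      case 1 then show ?thesis using loop CZ by simp
    next
      case 2 then show ?thesis using parallel_e CZ by simp
    next
      case 3
      have "f \<in> D \<longleftrightarrow> g \<in> D" if D: "D \<in> Z" for D
      proof
        assume "f \<in> D" then show "g \<in> D" using sub D 3(1) by blast
      next
        assume g: "g \<in> D"
        show "f \<in> D"
        proof (rule ccontr)
          assume "f \<notin> D"
          \<comment> \<open>Adding \<open>C\<close> gives a cycle through \<open>f\<close> that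
            misses \<open>g\<close>, although it must contain \<open>C\<close>.\<close>
          then have "f \<in> sym_diff C D" "g \<notin> sym_diff C D" using C(2) 3(1) g by auto
          then show False using sub[OF cycle_spaceD(5)[OF Z CZ D]] 3(1) by blast
        qed
      qed
      then show ?thesis using series[of g] 3 cycle_spaceD(2)[OF Z CZ] by blast
    qed
  qed
qed

lemma es_ground_insert: "es_ground (insert f E) = insert (Some (Some f)) (es_ground E)"
  unfolding es_ground_def by auto

text \<open>The parity condition is met by adding \<open>q\<close> to a loop in \<open>X\<close>, by
  pairing \<open>f \<in> X\<close> with \<open>e\<close>, by pairing \<open>f \<notin> X\<close>
  with the uncounted \<open>\<gamma>\<close>, or by equal membership of two parallel elements in
  \<open>X\<close>.\<close>

lemma es_cycles_pairs:
  assumes "e \<in> X" "e \<in> E" "f \<noteq> e" "f \<in> E"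
  shows "{f} \<in> Z \<Longrightarrow> f \<notin> X \<Longrightarrow> {Some (Some f)} \<in> es_cycles E Z X e"
    and "{f} \<in> Z \<Longrightarrow> f \<in> X \<Longrightarrow> {Some (Some f), None} \<in> es_cycles E Z X e"
    and "{f, e} \<in> Z \<Longrightarrow> f \<in> X \<Longrightarrow> {Some (Some f), Some (Some e)} \<in> es_cycles E Z X e"
    and "{f, e} \<in> Z \<Longrightarrow> f \<notin> X \<Longrightarrow> {Some (Some f), Some None} \<in> es_cycles E Z X e"
    and "{f, g} \<in> Z \<Longrightarrow> f \<noteq> g \<Longrightarrow> g \<in> E \<Longrightarrow> (f \<in> X \<longleftrightarrow> g \<in> X) \<Longrightarrow>
      {Some (Some f), Some (Some g)} \<in> es_cycles E Z X e"
proof -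
  have I: "D \<in> es_cycles E Z X e" if "D \<subseteq> es_ground E" "es_base e D = B" "B \<in> Z"
    "{y\<in>X. Some (Some y) \<in> D} = Y" "None \<in> D \<longleftrightarrow> odd (card Y)" for D B Y
    using that unfolding es_cycles_def by simp
  note defs = es_base_def es_ground_def
  show "{f} \<in> Z \<Longrightarrow> f \<notin> X \<Longrightarrow> {Some (Some f)} \<in> es_cycles E Z X e"
    by (rule I[of _ "{f}" "{}"]) (use assms in \<open>auto simp: defs\<close>)
  show "{f} \<in> Z \<Longrightarrow> f \<in> X \<Longrightarrow> {Some (Some f), None} \<in> es_cycles E Z X e"
    by (rule I[of _ "{f}" "{f}"]) (use assms in \<open>auto simp: defs\<close>)
  show "{f, e} \<in> Z \<Longrightarrow> f \<in> X \<Longrightarrow> {Some (Some f), Some (Some e)} \<in> es_cycles E Z X e"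
    by (rule I[of _ "{f, e}" "{f, e}"]) (use assms in \<open>auto simp: defs\<close>)
  show "{f, e} \<in> Z \<Longrightarrow> f \<notin> X \<Longrightarrow> {Some (Some f), Some None} \<in> es_cycles E Z X e"
    by (rule I[of _ "{f, e}" "{}"]) (use assms in \<open>auto simp: defs\<close>)
  show "{f, g} \<in> Z \<Longrightarrow> f \<noteq> g \<Longrightarrow> g \<in> E \<Longrightarrow> (f \<in> X \<longleftrightarrow> g \<in> X) \<Longrightarrow>
      {Some (Some f), Some (Some g)} \<in> es_cycles E Z X e"
    by (rule I[of _ "{f, g}" "if f \<in> X then {f, g} else {}"]) (use assms in \<open>auto simp: defs\<close>)
qed

text \<open>If \<open>e\<close> is not a loop, the only circuit is \<open>{e, \<gamma>, q}\<close>,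
  a parallel pair with a series extension. If it is a loop, then \<open>\<gamma>\<close> is a loop
  and \<open>e\<close> is parallel to \<open>q\<close>.\<close>

lemma gammoid_space_es_cycles_singleton:
  assumes Z: "cycle_space {e} Z" and e: "e \<in> X"
  shows "gammoid_space (es_ground {e}) (es_cycles {e} Z X e)"
proof -
  let ?e = "Some (Some e)" and ?g = "Some None :: 'a option option" and ?q = "None :: 'a option option"
  have gr: "es_ground {e} = {?e, ?g, ?q}" unfolding es_ground_def by auto
  have subs: "D \<in> {{}, {?e}, {?g}, {?q}, {?e, ?g}, {?e, ?q}, {?g, ?q}, {?e, ?g, ?q}}"
    if "D \<subseteq> {?e, ?g, ?q}" for D
  proof -
    have "D \<in> Pow {?e, ?g, ?q}" using that by simp
    then show ?thesis unfolding Pow_insert Pow_empty by auto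
  qed
  have X: "{y\<in>X. y = e} = {e}" using e by auto
  have 0: "gammoid_space {?q} {{}}" by (rule gammoid_space_coloop[OF gammoid_space_empty]) auto
  have "Z \<subseteq> {{}, {e}}" "{} \<in> Z" using cycle_spaceD(2,4)[OF Z] by auto
  then consider "Z = {{}}" | "Z = {{}, {e}}" by blast
  then show ?thesis
  proof cases
    case 1
    have eq: "es_cycles {e} Z X e = {{}, {?e, ?g, ?q}}"
    proof (intro equalityI subsetI)
      fix D assume D: "D \<in> es_cycles {e} Z X e"
      then have "D \<subseteq> {?e, ?g, ?q}" unfolding es_cycles_def gr by auto
      from subs[OF this] show "D \<in> {{}, {?e, ?g, ?q}}"
        using D unfolding es_cycles_def es_base_def 1 by (auto simp: X)
    qed (auto simp: es_cycles_def es_base_def 1 gr X)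
    have "gammoid_space {?g, ?q} {{}, {?g, ?q}}"
    proof (rule gammoid_space_parallel[where g = ?q])
      have "{D \<in> {{}, {?g, ?q}}. ?g \<notin> D} = {{}}" by auto
      then show "gammoid_space {?q} {D \<in> {{}, {?g, ?q}}. ?g \<notin> D}" using 0 by simp
    qed (auto simp: cycle_space_def)
    moreover have "(\<lambda>D. D - {?e}) ` {{}, {?e, ?g, ?q}} = {{}, {?g, ?q}}" by auto
    ultimately have "gammoid_space {?g, ?q} ((\<lambda>D. D - {?e}) ` {{}, {?e, ?g, ?q}})" by simp
    then have "gammoid_space {?e, ?g, ?q} {{}, {?e, ?g, ?q}}"
      by (rule gammoid_space_series[where g = ?g]) auto
    then show ?thesis unfolding eq gr .
  next
    case 2
    let ?Z = "{{}, {?g}, {?e, ?q}, {?e, ?g, ?q}}"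
    have "D \<in> es_cycles {e} Z X e \<longleftrightarrow> D \<subseteq> {?e, ?g, ?q} \<and> (?q \<in> D \<longleftrightarrow> ?e \<in> D)" for D
    proof (cases "D \<subseteq> {?e, ?g, ?q}")
      case True
      then have "es_base e D \<subseteq> {e}" unfolding es_base_def by auto
      then have "es_base e D \<in> Z" unfolding 2 by auto
      moreover have "{y\<in>X. Some (Some y) \<in> D} = (if ?e \<in> D then {e} else {})" using True e by auto
      ultimately show ?thesis unfolding es_cycles_def gr using True by simp
    qed (auto simp: es_cycles_def gr)
    moreover have "D \<in> ?Z" if "D \<subseteq> {?e, ?g, ?q}" "?q \<in> D \<longleftrightarrow> ?e \<in> D" for D
      using subs[OF that(1)] that(2) by auto
    ultimately have eq: "es_cycles {e} Z X e = ?Z" by (intro equalityI subsetI) auto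
    have "gammoid_space {?g, ?q} {{}, {?g}}"
    proof (rule gammoid_space_loop)
      have "{D \<in> {{}, {?g}}. ?g \<notin> D} = {{}}" by auto
      then show "gammoid_space {?q} {D \<in> {{}, {?g}}. ?g \<notin> D}" using 0 by simp
    qed auto
    moreover have "{D \<in> ?Z. ?e \<notin> D} = {{}, {?g}}" by auto
    ultimately have del: "gammoid_space {?g, ?q} {D \<in> ?Z. ?e \<notin> D}" by simp
    have "cycle_space {?e, ?g, ?q} ?Z"
      using cycle_space_es_cycles[OF Z, of X e] unfolding eq gr .
    then have "gammoid_space {?e, ?g, ?q} ?Z"
      by (rule gammoid_space_parallel[OF _ del, where g = ?q]) simp_all
    then show ?thesis unfolding eq gr .
  qed
qed

text \<open>Each reduction of \<open>B\<close> at some \<open>f \<noteq> e\<close> induces one of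
  the es-splitting: a loop in \<open>X\<close> becomes parallel to \<open>q\<close>, an element
  parallel to \<open>e\<close> becomes parallel to \<open>e\<close> or \<open>\<gamma>\<close>, and
  series partners other than \<open>e\<close> stay in series.\<close>

lemma gammoid_space_es_cycles:
  assumes "cycle_space E Z" "theta_free Z" "e \<in> E" "e \<in> X"
  shows "gammoid_space (es_ground E) (es_cycles E Z X e)"
  using assms
proof (induction "card E" arbitrary: E Z X)
  case 0
  then show ?case using cycle_spaceD(1)[OF 0(2)] by auto
next
  case (Suc n)
  note Z = Suc.prems(1) and tf = Suc.prems(2) and eE = Suc.prems(3) and eX = Suc.prems(4)
  have fin: "finite E" using cycle_spaceD(1)[OF Z] .
  show ?case
  proof (cases "E = {e}")
    case True
    then show ?thesis using gammoid_space_es_cycles_singleton Z eX by simp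
  next
    case False
    have delete: "gammoid_space (es_ground (E - {f})) {D \<in> es_cycles E Z X e. Some (Some f) \<notin> D}"
      if f: "f \<in> E" "f \<noteq> e" for f
    proof -
      have E: "E = insert f (E - {f})" using f by auto
      have "cycle_space (E - {f}) {D\<in>Z. f \<notin> D}" using Z E by (intro cycle_space_delete) simp
      then have "gammoid_space (es_ground (E - {f})) (es_cycles (E - {f}) {D\<in>Z. f \<notin> D} X e)"
        using Suc.hyps(2) fin f eE eX theta_free_delete[OF tf] by (intro Suc.hyps(1)) auto
      moreover have "{D \<in> es_cycles E Z X e. Some (Some f) \<notin> D} = es_cycles (E - {f}) {D\<in>Z. f \<notin> D} X e"
        using es_cycles_delete[of f "E - {f}" e Z X] f E by simp
      ultimately show ?thesis by simp
    qed
    have gr: "es_ground E = insert (Some (Some f)) (es_ground (E - {f}))" "Some (Some f) \<notin> es_ground (E - {f})"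
      if "f \<in> E" for f
      using es_ground_insert[of f "E - {f}"] that by (auto simp: insert_absorb es_ground_def)
    have par: ?thesis if f: "f \<in> E" "f \<noteq> e" and x: "x \<in> es_ground (E - {f})"
      "{Some (Some f), x} \<in> es_cycles E Z X e" for f x
      unfolding gr(1)[OF f(1)]
      by (rule gammoid_space_parallel[OF _ delete[OF f] gr(2)[OF f(1)] x])
        (use cycle_space_es_cycles[OF Z, of X e] gr(1)[OF f(1)] in simp)
    have par': ?thesis if "f \<in> E" "f \<noteq> e" "g \<in> E" "f \<noteq> g" "{f, g} \<in> Z" "f \<in> X \<longleftrightarrow> g \<in> X" for f g
      by (rule par[of f "Some (Some g)"]) (use that eX eE in \<open>auto simp: es_cycles_pairs es_ground_def\<close>)
    obtain f where f: "f \<in> E" "f \<noteq> e" using False eE by auto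
    show ?thesis
      using Z tf f(2)
    proof (cases rule: theta_free_cases)
      case coloop
      have nf: "Some (Some f) \<notin> D" if "D \<in> es_cycles E Z X e" for D
        using that coloop f(2) unfolding es_cycles_def es_base_def by (auto split: if_splits)
      then have "{D \<in> es_cycles E Z X e. Some (Some f) \<notin> D} = es_cycles E Z X e" by auto
      then have "gammoid_space (es_ground (E - {f})) (es_cycles E Z X e)" using delete[OF f] by simp
      then show ?thesis unfolding gr(1)[OF f(1)] using gr(2)[OF f(1)] nf by (rule gammoid_space_coloop)
    next
      case loop
      show ?thesis
      proof (cases "f \<in> X")
        case True
        then show ?thesis using par[OF f, of None] es_cycles_pairs(2)[OF eX eE f(2,1) loop]
          by (auto simp: es_ground_def)
      next
        case False
        then show ?thesis unfolding gr(1)[OF f(1)]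
          using gammoid_space_loop[OF delete[OF f] gr(2)[OF f(1)]] es_cycles_pairs(1)[OF eX eE f(2,1) loop] by simp
      qed
    next
      case parallel_e
      show ?thesis
      proof (cases "f \<in> X")
        case True
        then show ?thesis using par[OF f, of "Some (Some e)"] es_cycles_pairs(3)[OF eX eE f(2,1) parallel_e] eE f
          by (auto simp: es_ground_def)
      next
        case False
        then show ?thesis using par[OF f, of "Some None"] es_cycles_pairs(4)[OF eX eE f(2,1) parallel_e]
          by (auto simp: es_ground_def)
      qed
    next
      case (triple g h)
      have gh: "g \<in> E" "h \<in> E" using cycle_spaceD(2)[OF Z triple(1)] cycle_spaceD(2)[OF Z triple(2)] by auto
      have "sym_diff {f, g} {f, h} = {g, h}" using triple by auto
      then have "{g, h} \<in> Z" using cycle_spaceD(5)[OF Z triple(1,2)] by simp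
      \<comment> \<open>Two of \<open>f\<close>, \<open>g\<close>, \<open>h\<close> agree on
        membership in \<open>X\<close>, and these two stay parallel.\<close>
      then show ?thesis using par'[of f g] par'[of f h] par'[of g h] triple gh f by blast
    next
      case (series g)
      have E: "E = insert f (E - {f})" using f by auto
      let ?X = "if f \<in> X then sym_diff X {g} else X"
      have Zi: "cycle_space (insert f (E - {f})) Z" using Z E by simp
      have "gammoid_space (es_ground (E - {f})) (es_cycles (E - {f}) ((\<lambda>D. D - {f}) ` Z) ?X e)"
      proof (rule Suc.hyps(1))
        show "n = card (E - {f})" using Suc.hyps(2) fin f by simp
        show "cycle_space (E - {f}) ((\<lambda>D. D - {f}) ` Z)" by (rule cycle_space_contract[OF Zi]) auto
        show "theta_free ((\<lambda>D. D - {f}) ` Z)" by (rule theta_free_contract[OF tf series(2)[symmetric] series(4)])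
        show "e \<in> E - {f}" "e \<in> ?X" using eE eX f series by auto
      qed
      moreover have "(\<lambda>D. D - {Some (Some f)}) ` es_cycles E Z X e =
        es_cycles (E - {f}) ((\<lambda>D. D - {f}) ` Z) ?X e"
        using es_cycles_contract[OF Zi, of e g X] f series E by simp
      ultimately have "gammoid_space (es_ground (E - {f})) ((\<lambda>D. D - {Some (Some f)}) ` es_cycles E Z X e)" by simp
      moreover have "Some (Some f) \<in> D \<longleftrightarrow> Some (Some g) \<in> D" if "D \<in> es_cycles E Z X e" for D
        using that series(4)[of "es_base e D"] series(2,3) f(2)
        unfolding es_cycles_def es_base_def by (auto split: if_splits)
      moreover have "Some (Some g) \<in> es_ground (E - {f})" using series unfolding es_ground_def by auto
      ultimately show ?thesis unfolding gr(1)[OF f(1)] using gr(2)[OF f(1)]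
        by (intro gammoid_space_series[where g = "Some (Some g)"])
    qed
  qed
qed

section \<open>The minor \<open>M(G\<^sub>8)\<close>\<close>

text \<open>Three vertices bound the length of a cycle by three. Length one needs a loop, and length
  two needs equal ends, which only the edges 2 and 3 have.\<close>

lemma contains_cycle_G8_iff:
  assumes "I \<subseteq> {0, 1, 2, 3}"
  shows "(\<exists>C. C \<subseteq> I \<and> cycle_edges G\<^sub>8 C) \<longleftrightarrow> {2, 3} \<subseteq> I \<or> {0, 1, 2} \<subseteq> I \<or> {0, 1, 3} \<subseteq> I"
    (is "?L \<longleftrightarrow> ?R")
proof
  assume ?L
  then obtain vs es where es: "es \<noteq> []" "length vs = length es" "distinct vs" "distinct es"
    "set vs \<subseteq> {0, 1, 2}" "set es \<subseteq> I"
    and ends: "\<And>i. i < length es \<Longrightarrow> gends G\<^sub>8 (es ! i) = {vs ! i, vs ! (Suc i mod length es)}"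
    unfolding cycle_edges_def G\<^sub>8_def by auto
  have "card (set vs) \<le> card {0::nat, 1, 2}" using es(5) by (intro card_mono) auto
  then have "length es \<le> 3" using es(2,3) by (simp add: distinct_card)
  then consider "length es = 1" | "length es = 2" | "length es = 3"
    using es(1) by (cases es) (auto simp: le_Suc_eq numeral_eq_Suc)
  then show ?R
  proof cases
    case 1
    then show ?thesis using ends[of 0] by (auto simp: G\<^sub>8_def split: if_splits)
  next
    case 2
    then have eq: "gends G\<^sub>8 (es ! 0) = gends G\<^sub>8 (es ! 1)" using ends[of 0] ends[of 1] by (auto simp: insert_commute)
    have mem: "es ! 0 \<in> I" "es ! 1 \<in> I" using es(6) 2 by (auto simp: subset_iff)
    have ne: "es ! 0 \<noteq> es ! 1" using es(4) 2 by (simp add: nth_eq_iff_index_eq)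
    have "es ! 0 \<in> {0, 1, 2, 3}" "es ! 1 \<in> {0, 1, 2, 3}" using mem assms by auto
    then have "{es ! 0, es ! 1} = {2, 3}" using eq ne by (auto simp: G\<^sub>8_def doubleton_eq_iff)
    then show ?thesis using mem by (metis empty_subsetI insert_subset)
  next
    case 3
    show ?thesis
    proof (rule ccontr)
      assume no: "\<not> ?R"
      \<comment> \<open>A set containing none of the three patterns has at most two edges, too few
        for a cycle of length three.\<close>
      have "\<exists>A. I \<subseteq> A \<and> card A = 2 \<and> finite A"
      proof -
        consider "2 \<notin> I" "3 \<notin> I" | "2 \<notin> I" "3 \<in> I" | "2 \<in> I" "3 \<notin> I" using no by auto
        then show ?thesis
        proof cases
          case 1
          then have "I \<subseteq> {0, 1}" using assms by auto
          then show ?thesis by (intro exI[of _ "{0, 1}"]) auto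
        next
          case 2
          then have "I \<subseteq> {0, 3} \<or> I \<subseteq> {1, 3}" using assms no by auto
          then show ?thesis
          proof
            assume "I \<subseteq> {0, 3}" then show ?thesis by (intro exI[of _ "{0, 3}"]) auto
          next
            assume "I \<subseteq> {1, 3}" then show ?thesis by (intro exI[of _ "{1, 3}"]) auto
          qed
        next
          case 3
          then have "I \<subseteq> {0, 2} \<or> I \<subseteq> {1, 2}" using assms no by auto
          then show ?thesis
          proof
            assume "I \<subseteq> {0, 2}" then show ?thesis by (intro exI[of _ "{0, 2}"]) auto
          next
            assume "I \<subseteq> {1, 2}" then show ?thesis by (intro exI[of _ "{1, 2}"]) auto
          qed
        qed
      qed
      then obtain A where "I \<subseteq> A" "card A = 2" "finite A" by blast
      then have "card (set es) \<le> 2" using es(6) card_mono[of A "set es"] by auto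
      then show False using 3 es(4) by (simp add: distinct_card)
    qed
  qed
next
  have cyc: "cycle_edges G\<^sub>8 (set es)" if "es \<noteq> []" "length vs = length es" "distinct vs" "distinct es"
    "set vs \<subseteq> {0, 1, 2}" "set es \<subseteq> {0, 1, 2, 3}"
    "\<And>i. i < length es \<Longrightarrow> gends G\<^sub>8 (es ! i) = {vs ! i, vs ! (Suc i mod length es)}" for vs es
    unfolding cycle_edges_def using that by (intro exI[of _ vs] exI[of _ es]) (auto simp: G\<^sub>8_def)
  have "cycle_edges G\<^sub>8 (set [2, 3])"
  proof (rule cyc[of _ "[1, 2]"])
    fix i assume "i < length [2::nat, 3]"
    then have "i = 0 \<or> i = 1" by auto
    then show "gends G\<^sub>8 ([2, 3] ! i) = {[1, 2] ! i, [1, 2] ! (Suc i mod length [2::nat, 3])}"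
      by (elim disjE) (auto simp: G\<^sub>8_def)
  qed simp_all
  moreover have "cycle_edges G\<^sub>8 (set [0, k, 1])" if "k \<in> {2, 3}" for k
  proof (rule cyc[of _ "[0, 1, 2]"])
    fix i assume "i < length [0, k, 1]"
    then have "i = 0 \<or> i = 1 \<or> i = 2" by auto
    then show "gends G\<^sub>8 ([0, k, 1] ! i) = {[0, 1, 2] ! i, [0, 1, 2] ! (Suc i mod length [0, k, 1])}"
      using that by (elim disjE) (auto simp: G\<^sub>8_def)
  qed (use that in auto)
  then have "cycle_edges G\<^sub>8 (set [0, 2, 1])" "cycle_edges G\<^sub>8 (set [0, 3, 1])" by blast+
  moreover assume ?R
  ultimately show ?L by (metis list.set insert_commute)
qed

lemma indeps_cycle_matroid_G8:
  "I \<in> indeps (cycle_matroid G\<^sub>8) \<longleftrightarrow>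
    I \<subseteq> {0, 1, 2, 3} \<and> \<not> {2, 3} \<subseteq> I \<and> \<not> {0, 1, 2} \<subseteq> I \<and> \<not> {0, 1, 3} \<subseteq> I"
  using contains_cycle_G8_iff[of I] unfolding cycle_matroid_def by (auto simp: G\<^sub>8_def)

lemma ground_cycle_matroid_G8: "ground (cycle_matroid G\<^sub>8) = {0, 1, 2, 3}"
  unfolding cycle_matroid_def G\<^sub>8_def by simp

section \<open>From thetas to minors\<close>

lemma basis_of_indep:
  assumes "S \<in> indeps M"
  shows "basis_of M S J \<longleftrightarrow> J = S"
  using assms unfolding basis_of_def by blast

text \<open>Contract \<open>S\<close> and delete everything outside \<open>S \<union> {a, b, c, d}\<close>; the elements \<open>a, b, c, d\<close>
  become the edges \<open>0, 1, 2, 3\<close>.\<close>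

lemma has_minor_G8I:
  assumes E: "S \<union> {a, b, c, d} \<subseteq> E" and disj: "S \<inter> {a, b, c, d} = {}"
    and dist: "distinct [a, b, c, d]"
    and cyc: "\<And>D. D \<subseteq> S \<union> {a, b, c, d} \<Longrightarrow> D \<in> Z \<longleftrightarrow>
      D = {} \<or> D = S1 \<union> {a, b, c} \<or> D = S2 \<union> {c, d} \<or> D = S3 \<union> {a, b, d}"
    and S: "S1 \<subseteq> S" "S2 \<subseteq> S" "S3 \<subseteq> S"
  shows "has_minor_iso (space_matroid E Z) (cycle_matroid G\<^sub>8)"
proof -
  define T where "T = E - (S \<union> {a, b, c, d})"
  let ?M = "space_matroid E Z"
  have indep: "indep_in Z W \<longleftrightarrow> \<not> S1 \<union> {a, b, c} \<subseteq> W \<and> \<not> S2 \<union> {c, d} \<subseteq> W \<and> \<not> S3 \<union> {a, b, d} \<subseteq> W"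
    if W: "W \<subseteq> S \<union> {a, b, c, d}" for W
  proof -
    have "S1 \<union> {a, b, c} \<in> Z" "S2 \<union> {c, d} \<in> Z" "S3 \<union> {a, b, d} \<in> Z"
      using S by (subst cyc; auto)+
    then show ?thesis unfolding indep_in_def using cyc W by (smt (verit) Un_insert_right insert_not_empty subset_trans)
  qed
  have "indep_in Z S" using indep[of S] disj by auto
  then have "S \<in> indeps ?M" using E unfolding space_matroid_def by auto
  \<comment> \<open>An independent \<open>S\<close> is its own only basis, so the contraction just
    tests \<open>I \<union> S\<close>.\<close>
  note basis = basis_of_indep[OF this]
  have ground: "ground (deletion (contraction ?M S) T) = {a, b, c, d}"
    using E disj unfolding deletion_def contraction_def space_matroid_def T_def by auto
  have ind: "I \<in> indeps (deletion (contraction ?M S) T) \<longleftrightarrow>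
    \<not> {c, d} \<subseteq> I \<and> \<not> {a, b, c} \<subseteq> I \<and> \<not> {a, b, d} \<subseteq> I" if I: "I \<subseteq> {a, b, c, d}" for I
  proof -
    have "I \<in> indeps (deletion (contraction ?M S) T) \<longleftrightarrow> indep_in Z (I \<union> S)"
      unfolding deletion_def contraction_def basis using I E disj
      by (auto simp: space_matroid_def T_def)
    also have "\<dots> \<longleftrightarrow> \<not> {c, d} \<subseteq> I \<and> \<not> {a, b, c} \<subseteq> I \<and> \<not> {a, b, d} \<subseteq> I"
    proof -
      have nS: "a \<notin> S" "b \<notin> S" "c \<notin> S" "d \<notin> S" using disj by auto
      have "S1 \<union> {a, b, c} \<subseteq> I \<union> S \<longleftrightarrow> {a, b, c} \<subseteq> I" "S2 \<union> {c, d} \<subseteq> I \<union> S \<longleftrightarrow> {c, d} \<subseteq> I"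
        "S3 \<union> {a, b, d} \<subseteq> I \<union> S \<longleftrightarrow> {a, b, d} \<subseteq> I" using S nS by blast+
      moreover have "I \<union> S \<subseteq> S \<union> {a, b, c, d}" using I by blast
      ultimately show ?thesis using indep[of "I \<union> S"] by metis
    qed
    finally show ?thesis .
  qed
  define \<phi> where "\<phi> x = (if x = a then 0 else if x = b then 1 else if x = c then 2 else (3::nat))" for x
  have \<phi>: "\<phi> a = 0" "\<phi> b = 1" "\<phi> c = 2" "\<phi> d = 3" using dist unfolding \<phi>_def by auto
  have bij: "bij_betw \<phi> {a, b, c, d} {0, 1, 2, 3}" unfolding bij_betw_def inj_on_def using \<phi> by auto
  have "matroid_iso (deletion (contraction ?M S) T) (cycle_matroid G\<^sub>8)"
    unfolding matroid_iso_def ground ground_cycle_matroid_G8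
  proof (intro exI[of _ \<phi>] conjI allI impI bij)
    fix I assume I: "I \<subseteq> {a, b, c, d}"
    have mem: "\<phi> x \<in> \<phi> ` I \<longleftrightarrow> x \<in> I" if "x \<in> {a, b, c, d}" for x
      using bij I that by (meson bij_betw_imp_inj_on inj_on_image_mem_iff)
    have eqs: "0 \<in> \<phi> ` I \<longleftrightarrow> a \<in> I" "1 \<in> \<phi> ` I \<longleftrightarrow> b \<in> I" "2 \<in> \<phi> ` I \<longleftrightarrow> c \<in> I" "3 \<in> \<phi> ` I \<longleftrightarrow> d \<in> I"
      using mem[of a, unfolded \<phi>] mem[of b, unfolded \<phi>] mem[of c, unfolded \<phi>] mem[of d, unfolded \<phi>]
      by blast+
    have "\<phi> ` I \<subseteq> {0, 1, 2, 3}" using image_mono[OF I, of \<phi>] bij unfolding bij_betw_def by argo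
    then show "I \<in> indeps (deletion (contraction ?M S) T) \<longleftrightarrow> \<phi> ` I \<in> indeps (cycle_matroid G\<^sub>8)"
      unfolding ind[OF I] indeps_cycle_matroid_G8 insert_subset eqs by blast
  qed
  moreover have "S \<subseteq> ground ?M" "T \<subseteq> ground ?M" "S \<inter> T = {}"
    using E unfolding T_def space_matroid_def by auto
  ultimately show ?thesis unfolding has_minor_iso_def by blast
qed

text \<open>Among the circuits meeting a circuit \<open>C\<close> with at least three elements, one with fewest elements
  outside \<open>C\<close> spans a theta together with \<open>C\<close>.\<close>

lemma theta_free_if_no_minor_G8:
  assumes Z: "cycle_space E Z" and no: "\<not> has_minor_iso (space_matroid E Z) (cycle_matroid G\<^sub>8)"
  shows "theta_free Z"
  unfolding theta_free_def
proof (intro allI impI, elim conjE, rule ccontr)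
  fix C D0 assume C: "circuit_of Z C" and D0: "circuit_of Z D0" "C \<noteq> D0" "C \<inter> D0 \<noteq> {}" and card: "card C \<noteq> 2"
  define P where "P D \<longleftrightarrow> circuit_of Z D \<and> C \<noteq> D \<and> C \<inter> D \<noteq> {}" for D
  have "P D0" using D0 unfolding P_def by auto
  then obtain D where D: "P D" and min: "\<And>D'. P D' \<Longrightarrow> card (D - C) \<le> card (D' - C)"
    using ex_has_least_nat[of P D0 "\<lambda>D. card (D - C)"] by blast
  have circ: "circuit_of Z D" "C \<noteq> D" "C \<inter> D \<noteq> {}" using D unfolding P_def by auto
  have CZ: "C \<in> Z" and DZ: "D \<in> Z" using C circ unfolding circuit_of_def by auto
  have fin: "finite C" "finite D" using cycle_spaceD(3)[OF Z] CZ DZ by auto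
  have inC: "B = {} \<or> B = C" if "B \<in> Z" "B \<subseteq> C" for B using C that unfolding circuit_of_def by blast
  have inD: "B = {} \<or> B = D" if "B \<in> Z" "B \<subseteq> D" for B using circ(1) that unfolding circuit_of_def by blast
  have nsub: "C - D \<noteq> {}" "D - C \<noteq> {}" using inC[OF DZ] inD[OF CZ] circ C unfolding circuit_of_def by blast+
  \<comment> \<open>A cycle meeting \<open>D - C\<close> contains all of it, as otherwise a circuit
    inside it contradicts the choice of \<open>D\<close>. Adding \<open>D\<close> then leaves a
    cycle inside \<open>C\<close>.\<close>
  have cycles: "B = {} \<or> B = C \<or> B = D \<or> B = sym_diff C D" if B: "B \<in> Z" "B \<subseteq> C \<union> D" for B
  proof (cases "B \<inter> (D - C) = {}")
    case True
    then have "B \<subseteq> C" using B(2) by blast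
    then show ?thesis using inC B(1) by blast
  next
    case False
    then obtain x where x: "x \<in> B" "x \<in> D" "x \<notin> C" by blast
    have "D - C \<subseteq> B"
    proof (rule ccontr)
      assume nB: "\<not> D - C \<subseteq> B"
      obtain B' where B': "circuit_of Z B'" "x \<in> B'" "B' \<subseteq> B" using circuit_through[OF Z B(1) x(1)] by metis
      have B'Z: "B' \<in> Z" using B'(1) unfolding circuit_of_def by auto
      show False
      proof (cases "B' \<inter> C = {}")
        case True
        then have "B' \<subseteq> D" using B' B(2) by blast
        then show False using inD[OF B'Z] True circ(3) B'(2) by blast
      next
        case False
        then have "P B'" using B' x unfolding P_def by blast
        moreover have "card (B' - C) < card (D - C)"
          using B' B(2) nB fin by (intro psubset_card_mono) auto
        ultimately show False using min by fastforce
      qed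
    qed
    then have "sym_diff B D \<subseteq> C" using B(2) by blast
    then have "sym_diff B D = {} \<or> sym_diff B D = C" using inC cycle_spaceD(5)[OF Z B(1) DZ] by blast
    then show ?thesis by blast
  qed
  have CDZ: "sym_diff C D \<in> Z" using cycle_spaceD(5)[OF Z CZ DZ] .
  have sub: "C \<union> D \<subseteq> E" using cycle_spaceD(2)[OF Z] CZ DZ by blast
  obtain x y where xy: "x \<in> C - D" "y \<in> C \<inter> D" using nsub circ(3) by blast
  then have "x \<noteq> y" by blast
  then have "card {x, y} = 2" by simp
  then have "C \<noteq> {x, y}" using card by metis
  then obtain z where z: "z \<in> C" "z \<noteq> x" "z \<noteq> y" using xy by blast
  obtain w where w: "w \<in> D - C" using nsub by blast
  have "has_minor_iso (space_matroid E Z) (cycle_matroid G\<^sub>8)"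
  \<comment> \<open>The theta has the three parts \<open>C - D\<close>, \<open>C \<inter> D\<close>
    and \<open>D - C\<close>. The part containing \<open>z\<close> keeps two elements, the series
    edges 0 and 1; the other two parts keep one each, the parallel edges 2 and 3.\<close>
  proof (cases "z \<in> D")
    case True
    define S where "S = C \<union> D - {y, z, x, w}"
    have W: "S \<union> {y, z, x, w} = C \<union> D" using xy z w True unfolding S_def by blast
    show ?thesis
    proof (rule has_minor_G8I[of S y z x w E Z "C - {y, z, x}" "sym_diff C D - {x, w}" "D - {y, z, w}"])
      have sets: "C - {y, z, x} \<union> {y, z, x} = C" "sym_diff C D - {x, w} \<union> {x, w} = sym_diff C D"
        "D - {y, z, w} \<union> {y, z, w} = D" using xy z w True by blast+
      show "B \<in> Z \<longleftrightarrow> B = {} \<or> B = C - {y, z, x} \<union> {y, z, x} \<or> B = sym_diff C D - {x, w} \<union> {x, w} \<or>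
        B = D - {y, z, w} \<union> {y, z, w}" if "B \<subseteq> S \<union> {y, z, x, w}" for B
        unfolding sets using cycles[of B] that CZ DZ CDZ cycle_spaceD(4)[OF Z] unfolding W by blast
      show "S \<union> {y, z, x, w} \<subseteq> E" unfolding W by (rule sub)
    qed (use xy z w True in \<open>auto simp: S_def\<close>)
  next
    case False
    define S where "S = C \<union> D - {x, z, y, w}"
    have W: "S \<union> {x, z, y, w} = C \<union> D" using xy z w False unfolding S_def by blast
    show ?thesis
    proof (rule has_minor_G8I[of S x z y w E Z "C - {x, z, y}" "D - {y, w}" "sym_diff C D - {x, z, w}"])
      have sets: "C - {x, z, y} \<union> {x, z, y} = C" "D - {y, w} \<union> {y, w} = D"
        "sym_diff C D - {x, z, w} \<union> {x, z, w} = sym_diff C D" using xy z w False by blast+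
      show "B \<in> Z \<longleftrightarrow> B = {} \<or> B = C - {x, z, y} \<union> {x, z, y} \<or> B = D - {y, w} \<union> {y, w} \<or>
        B = sym_diff C D - {x, z, w} \<union> {x, z, w}" if "B \<subseteq> S \<union> {x, z, y, w}" for B
        unfolding sets using cycles[of B] that CZ DZ CDZ cycle_spaceD(4)[OF Z] unfolding W by blast
      show "S \<union> {x, z, y, w} \<subseteq> E" unfolding W by (rule sub)
    qed (use xy z w False in \<open>auto simp: S_def\<close>)
  qed
  then show False using no by contradiction
qed

section \<open>From the minor to an es-splitting that is not a gammoid\<close>

text \<open>A contraction only asks for some basis of \<open>S\<close>. Modulo \<open>Z\<close>, the
  part of a cycle in \<open>J'\<close> can be replaced by a subset of \<open>J\<close>, so all bases
  give the same answer.\<close>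

lemma indep_in_Un_basis:
  assumes Z: "cycle_space E Z" and J: "basis_of (space_matroid E Z) S J" and J': "basis_of (space_matroid E Z) S J'"
    and I: "I \<inter> S = {}" "indep_in Z (I \<union> J)"
  shows "indep_in Z (I \<union> J')"
  unfolding indep_in_def
proof (intro ballI impI)
  fix D assume D: "D \<in> Z" "D \<subseteq> I \<union> J'"
  have sub: "J \<subseteq> S" "J' \<subseteq> S" "J \<subseteq> E" "J' \<subseteq> E" and ind: "indep_in Z J" "indep_in Z J'"
    using J J' unfolding basis_of_def space_matroid_def by auto
  have "\<not> indep_in Z (insert x J)" if "x \<in> D \<inter> J' - J" for x
    using that J sub unfolding basis_of_def space_matroid_def by auto
  moreover have "finite (D \<inter> J')" using cycle_spaceD(3)[OF Z D(1)] by simp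
  ultimately obtain L where L: "L \<subseteq> J" "sym_diff (D \<inter> J') L \<in> Z"
    using congruent_subset_of_spanning[OF Z ind(1), of "D \<inter> J'"] by blast
  have "sym_diff D (sym_diff (D \<inter> J') L) \<subseteq> I \<union> J" using D(2) L(1) by blast
  then have "sym_diff D (sym_diff (D \<inter> J') L) = {}"
    using I(2) cycle_spaceD(5)[OF Z D(1) L(2)] unfolding indep_in_def by blast
  then have "D = sym_diff (D \<inter> J') L" by blast
  then have "D \<subseteq> S" using L(1) sub by blast
  then have "D \<subseteq> J'" using D(2) I(1) by blast
  then show "D = {}" using ind(2) D(1) unfolding indep_in_def by blast
qed

text \<open>A single basis \<open>J\<close> of the contracted set serves every test: circuits of the
  minor become cycles after adding part of \<open>J\<close>, and independent sets stay independent
  with all of \<open>J\<close>.\<close>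

lemma has_minor_G8E:
  assumes Z: "cycle_space E Z" and minor: "has_minor_iso (space_matroid E Z) (cycle_matroid G\<^sub>8)"
  obtains J a b c d K L where "J \<union> {a, b, c, d} \<subseteq> E" "J \<inter> {a, b, c, d} = {}" "distinct [a, b, c, d]"
    "indep_in Z (J \<union> {a, d})" "indep_in Z (J \<union> {b, c})"
    "K \<subseteq> J" "K \<union> {a, b, c} \<in> Z" "L \<subseteq> J" "L \<union> {c, d} \<in> Z"
proof -
  let ?M = "space_matroid E Z"
  obtain S T where S: "S \<subseteq> ground ?M"
    and iso: "matroid_iso (deletion (contraction ?M S) T) (cycle_matroid G\<^sub>8)"
    using minor unfolding has_minor_iso_def by blast
  let ?N = "deletion (contraction ?M S) T"
  obtain \<phi> where bij: "bij_betw \<phi> (ground ?N) {0, 1, 2, 3}"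
    and ind: "\<And>I. I \<subseteq> ground ?N \<Longrightarrow> I \<in> indeps ?N \<longleftrightarrow> \<phi> ` I \<in> indeps (cycle_matroid G\<^sub>8)"
    using iso unfolding matroid_iso_def ground_cycle_matroid_G8 by blast
  define \<psi> where "\<psi> = the_inv_into (ground ?N) \<phi>"
  have \<psi>: "\<psi> i \<in> ground ?N" "\<phi> (\<psi> i) = i" if "i \<in> {0, 1, 2, 3}" for i
    using bij that unfolding \<psi>_def by (metis bij_betw_def bij_betw_the_inv_into bij_betwE) (metis bij that f_the_inv_into_f_bij_betw)
  let ?a = "\<psi> 0" and ?b = "\<psi> 1" and ?c = "\<psi> 2" and ?d = "\<psi> 3"
  have dist: "distinct [?a, ?b, ?c, ?d]"
    using \<psi>(2)[of 0] \<psi>(2)[of 1] \<psi>(2)[of 2] \<psi>(2)[of 3] by (auto dest: arg_cong[of _ _ \<phi>])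
  have gr: "ground ?N = E - S - T" unfolding deletion_def contraction_def space_matroid_def by simp
  have indN: "\<psi> ` A \<in> indeps ?N \<longleftrightarrow> A \<in> indeps (cycle_matroid G\<^sub>8)" if "A \<subseteq> {0, 1, 2, 3}" for A
  proof -
    have "\<phi> (\<psi> i) = i" if "i \<in> A" for i using \<psi>(2) \<open>A \<subseteq> {0, 1, 2, 3}\<close> that by blast
    then have "\<phi> ` \<psi> ` A = A" unfolding image_image by simp
    then show ?thesis using ind[of "\<psi> ` A"] \<psi>(1) that by auto
  qed
  have N: "\<psi> ` A \<in> indeps ?N \<longleftrightarrow> (\<exists>J. basis_of ?M S J \<and> indep_in Z (\<psi> ` A \<union> J))"
    if "A \<subseteq> {0, 1, 2, 3}" for A
  proof -
    have "\<psi> ` A \<subseteq> E - S - T" using \<psi>(1) that gr by auto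
    then show ?thesis using S unfolding deletion_def contraction_def
      by (auto simp: space_matroid_def basis_of_def)
  qed
  have "{} \<in> indeps ?N" using indN[of "{}"] by (simp add: indeps_cycle_matroid_G8)
  then obtain J where J: "basis_of ?M S J" using N[of "{}"] by auto
  have key: "indep_in Z (\<psi> ` A \<union> J) \<longleftrightarrow> A \<in> indeps (cycle_matroid G\<^sub>8)" if A: "A \<subseteq> {0, 1, 2, 3}" for A
  proof -
    have "\<psi> ` A \<inter> S = {}" using \<psi>(1) A gr by auto
    then show ?thesis using N[OF A] indN[OF A] J indep_in_Un_basis[OF Z _ J] by blast
  qed
  have JE: "J \<subseteq> S" "J \<subseteq> E" using J S unfolding basis_of_def space_matroid_def by auto
  have abcd: "{?a, ?b, ?c, ?d} \<subseteq> E - S" using \<psi>(1) gr by auto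
  have ext: "\<exists>K\<subseteq>J. K \<union> \<psi> ` A \<in> Z"
    if A: "A \<subseteq> {0, 1, 2, 3}" "A \<notin> indeps (cycle_matroid G\<^sub>8)"
      and less: "\<And>x. x \<in> A \<Longrightarrow> A - {x} \<in> indeps (cycle_matroid G\<^sub>8)" for A
  proof -
    obtain D where D: "D \<in> Z" "D \<subseteq> \<psi> ` A \<union> J" "D \<noteq> {}" using key[OF A(1)] A(2) unfolding indep_in_def by blast
    \<comment> \<open>A nonempty cycle missing \<open>\<psi> x\<close> would lie over the
      independent set \<open>A - {x}\<close>.\<close>
    have "\<psi> x \<in> D" if x: "x \<in> A" for x
    proof (rule ccontr)
      assume "\<psi> x \<notin> D"
      then have "D \<subseteq> \<psi> ` (A - {x}) \<union> J" using D(2) by blast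
      moreover have "indep_in Z (\<psi> ` (A - {x}) \<union> J)" using key[of "A - {x}"] less[OF x] A(1) by blast
      ultimately show False using D unfolding indep_in_def by blast
    qed
    then have "(D \<inter> J) \<union> \<psi> ` A = D" using D(2) by blast
    then show ?thesis using D(1) by (intro exI[of _ "D \<inter> J"]) auto
  qed
  have "\<exists>K\<subseteq>J. K \<union> \<psi> ` {0, 1, 2} \<in> Z" by (rule ext) (auto simp: indeps_cycle_matroid_G8)
  then obtain K where K: "K \<subseteq> J" "K \<union> {?a, ?b, ?c} \<in> Z" by auto
  have "\<exists>K\<subseteq>J. K \<union> \<psi> ` {2, 3} \<in> Z" by (rule ext) (auto simp: indeps_cycle_matroid_G8)
  then obtain L where L: "L \<subseteq> J" "L \<union> {?c, ?d} \<in> Z" by auto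
  have "indep_in Z (\<psi> ` {0, 3} \<union> J)" "indep_in Z (\<psi> ` {1, 2} \<union> J)"
    using key[of "{0, 3}"] key[of "{1, 2}"] by (auto simp: indeps_cycle_matroid_G8)
  then have "indep_in Z (J \<union> {?a, ?d})" "indep_in Z (J \<union> {?b, ?c})" by (simp_all add: Un_commute)
  then show ?thesis using that[of J ?a ?b ?c ?d K L] K L JE abcd dist by blast
qed

text \<open>For \<open>X = {a, c}\<close> the es-splitting with \<open>e = a\<close> has \<open>{a, q, d}\<close> and \<open>{\<gamma>, b, c}\<close> as bases
  of an \<open>M(K\<^sub>4)\<close>-minor; both \<open>a\<close> and \<open>d\<close> can be exchanged symmetrically with \<open>b\<close> only, so the
  minor is not base orderable.\<close>

lemma not_gammoid_es_splitting:
  assumes Z: "cycle_space E Z" and sub: "J \<union> {a, b, c, d} \<subseteq> E" and disj: "J \<inter> {a, b, c, d} = {}"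
    and dist: "distinct [a, b, c, d]" and ind: "indep_in Z (J \<union> {a, d})" "indep_in Z (J \<union> {b, c})"
    and K: "K \<subseteq> J" "K \<union> {a, b, c} \<in> Z" and L: "L \<subseteq> J" "L \<union> {c, d} \<in> Z"
  shows "\<not> gammoid_space (es_ground E) (es_cycles E Z {a, c} a)"
proof
  let ?s = "\<lambda>y. Some (Some y)" and ?g = "Some None :: 'a option option" and ?q = "None :: 'a option option"
  let ?Z = "es_cycles E Z {a, c} a"
  \<comment> \<open>Modulo \<open>J\<close> these are complementary three-edge paths of
    \<open>K\<^sub>4\<close>, with middle edges \<open>q\<close> and \<open>b\<close>.\<close>
  define I where "I = ?s ` J \<union> {?s a, ?q, ?s d}"
  define I' where "I' = ?s ` J \<union> {?g, ?s b, ?s c}"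
  assume "gammoid_space (es_ground E) ?Z"
  then obtain V :: "nat set" and A and \<phi> :: "'a option option \<Rightarrow> nat" where \<phi>: "inj_on \<phi> (es_ground E)"
    and pres': "\<forall>W. W \<subseteq> es_ground E \<longrightarrow> (indep_in ?Z W \<longleftrightarrow> (\<exists>s. avoiding_sdr V A (\<phi> ` W) s))"
    unfolding sdr_presented_def by (elim exE conjE) (rule that)
  note pres = pres'[rule_format]
  have cycI: "D \<in> ?Z" if "D \<subseteq> es_ground E" "es_base a D = B" "B \<in> Z"
    "{y\<in>{a, c}. ?s y \<in> D} = Y" "?q \<in> D \<longleftrightarrow> odd (card Y)" for D B Y
    using that unfolding es_cycles_def by simp
  have aJ: "a \<notin> J" "b \<notin> J" "c \<notin> J" "d \<notin> J" using disj by auto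
  have ne: "a \<noteq> b" "a \<noteq> c" "a \<noteq> d" "b \<noteq> c" "b \<noteq> d" "c \<noteq> d" using dist by auto
  have KE: "K \<subseteq> E" "L \<subseteq> E" using K L sub by auto
  have gr: "I \<subseteq> es_ground E" "I' \<subseteq> es_ground E" using sub unfolding I_def I'_def es_ground_def by auto
  \<comment> \<open>\<open>c1\<close> to \<open>c4\<close> are the triangles of
    \<open>K\<^sub>4\<close>; \<open>q\<close> occurs exactly in those with just one of
    \<open>a\<close> and \<open>c\<close>.\<close>
  have c1: "?s ` K \<union> {?s a, ?s b, ?s c} \<in> ?Z"
    by (rule cycI[of _ "K \<union> {a, b, c}" "{a, c}"])
      (use sub KE K aJ ne in \<open>auto simp: es_ground_def es_base_def\<close>)
  have c2: "?s ` L \<union> {?s c, ?s d, ?q} \<in> ?Z"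
    by (rule cycI[of _ "L \<union> {c, d}" "{c}"])
      (use sub KE L aJ ne in \<open>auto simp: es_ground_def es_base_def\<close>)
  have c3: "{?s a, ?g, ?q} \<in> ?Z"
    by (rule cycI[of _ "{}" "{a}"])
      (use sub aJ ne cycle_spaceD(4)[OF Z] in \<open>auto simp: es_ground_def es_base_def\<close>)
  have "sym_diff (sym_diff (?s ` K \<union> {?s a, ?s b, ?s c}) (?s ` L \<union> {?s c, ?s d, ?q})) {?s a, ?g, ?q} \<in> ?Z"
    using cycle_spaceD(5)[OF cycle_space_es_cycles[OF Z]] c1 c2 c3 by blast
  moreover have "sym_diff (sym_diff (?s ` K \<union> {?s a, ?s b, ?s c}) (?s ` L \<union> {?s c, ?s d, ?q})) {?s a, ?g, ?q} =
    ?s ` sym_diff K L \<union> {?s b, ?s d, ?g}"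
    using K L aJ ne by auto
  ultimately have c4: "?s ` sym_diff K L \<union> {?s b, ?s d, ?g} \<in> ?Z" by simp
  have dep: "\<not> indep_in ?Z W" if "C \<in> ?Z" "C \<subseteq> W" "x \<in> C" for W C x using that unfolding indep_in_def by blast
  have indI: "indep_in ?Z I" unfolding indep_in_def
  proof (intro ballI impI)
    fix D assume D: "D \<in> ?Z" "D \<subseteq> I"
    have ng: "?g \<notin> D" using D(2) unfolding I_def by auto
    have "es_base a D \<in> Z" using D(1) unfolding es_cycles_def by auto
    moreover have "es_base a D = {y. ?s y \<in> D}" using ng unfolding es_base_def by auto
    moreover have "{y. ?s y \<in> D} \<subseteq> J \<union> {a, d}" using D(2) unfolding I_def by auto
    ultimately have "{y. ?s y \<in> D} = {}" using ind(1) unfolding indep_in_def by auto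
    then have no: "\<And>y. ?s y \<notin> D" by auto
    then have "?q \<notin> D" using D(1) unfolding es_cycles_def by auto
    then show "D = {}" using no ng D(2) unfolding I_def by auto
  qed
  have indI': "indep_in ?Z I'" unfolding indep_in_def
  proof (intro ballI impI)
    fix D assume D: "D \<in> ?Z" "D \<subseteq> I'"
    have nq: "?q \<notin> D" and na: "?s a \<notin> D" using D(2) aJ ne unfolding I'_def by auto
    have BZ: "es_base a D \<in> Z" and even: "even (card {y \<in> {a, c}. ?s y \<in> D})"
      using D(1) nq unfolding es_cycles_def by auto
    have Y: "{y. ?s y \<in> D} \<subseteq> J \<union> {b, c}" using D(2) unfolding I'_def by auto
    \<comment> \<open>If \<open>\<gamma>\<close> occurs, it plays the role of \<open>a\<close> in
      the cycle \<open>K \<union> {a, b, c}\<close>. Then \<open>c\<close> is counted without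
      \<open>a\<close>, and the odd parity calls for \<open>q\<close>, which \<open>I'\<close>
      lacks.\<close>
    have "?g \<notin> D"
    proof
      assume g: "?g \<in> D"
      have base: "es_base a D = insert a {y. ?s y \<in> D}" using na g unfolding es_base_def by auto
      have "sym_diff (es_base a D) (K \<union> {a, b, c}) \<subseteq> J \<union> {b, c}" unfolding base using Y K(1) by auto
      then have "sym_diff (es_base a D) (K \<union> {a, b, c}) = {}"
        using ind(2) cycle_spaceD(5)[OF Z BZ K(2)] unfolding indep_in_def by blast
      then have "c \<in> es_base a D" by blast
      then have "?s c \<in> D" unfolding base using ne by auto
      then have "{y \<in> {a, c}. ?s y \<in> D} = {c}" using na by auto
      then show False using even by simp
    qed
    then have "es_base a D = {y. ?s y \<in> D}" unfolding es_base_def by auto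
    then have "{y. ?s y \<in> D} = {}" using BZ Y ind(2) unfolding indep_in_def by metis
    then show "D = {}" using nq \<open>?g \<notin> D\<close> D(2) unfolding I'_def by auto
  qed
  obtain s where s: "avoiding_sdr V A (\<phi> ` I) s" using pres[OF gr(1)] indI by blast
  obtain t where t: "avoiding_sdr V A (\<phi> ` I') t" using pres[OF gr(2)] indI' by blast
  let ?X = "{\<phi> (?s a), \<phi> (?s d)}"
  have aE: "?s a \<in> es_ground E" "?s d \<in> es_ground E" "?s b \<in> es_ground E" "?s c \<in> es_ground E"
    "?g \<in> es_ground E" using sub unfolding es_ground_def by auto
  have nX: "\<nexists>s. avoiding_sdr V A (insert x (\<phi> ` I')) s" if "x \<in> ?X" for x
  proof -
    have "\<not> indep_in ?Z (insert (?s a) I')" by (rule dep[OF c1, of _ "?s a"]) (use K in \<open>auto simp: I'_def\<close>)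
    moreover have "\<not> indep_in ?Z (insert (?s d) I')" by (rule dep[OF c4, of _ "?s d"]) (use K L in \<open>auto simp: I'_def\<close>)
    ultimately show ?thesis using that pres[of "insert (?s a) I'"] pres[of "insert (?s d) I'"] gr aE by auto
  qed
  have XI: "?X \<subseteq> \<phi> ` I" unfolding I_def by auto
  obtain \<pi> where inj: "inj_on \<pi> ?X" and \<pi>: "\<And>x. x \<in> ?X \<Longrightarrow> \<pi> x \<in> \<phi> ` I' - \<phi> ` I \<and>
      (\<exists>s. avoiding_sdr V A (insert (\<pi> x) (\<phi> ` I - {x})) s) \<and>
      (\<exists>s. avoiding_sdr V A (insert x (\<phi> ` I' - {\<pi> x})) s)"
    using avoiding_sdr_exchange[OF s t XI nX] by blast
  have exch: "\<exists>y\<in>I' - I. \<pi> (\<phi> x) = \<phi> y \<and> indep_in ?Z (insert y (I - {x})) \<and> indep_in ?Z (insert x (I' - {y}))"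
    if x: "x \<in> {?s a, ?s d}" for x
  proof -
    have xE: "x \<in> es_ground E" using x aE by auto
    have px: "\<phi> x \<in> ?X" using x by auto
    then obtain y where y: "y \<in> I' - I" "\<pi> (\<phi> x) = \<phi> y" using \<pi> by blast
    have yE: "y \<in> es_ground E" using y gr by auto
    have "\<phi> ` (I - {x}) = \<phi> ` I - {\<phi> x}" "\<phi> ` (I' - {y}) = \<phi> ` I' - {\<phi> y}"
      using inj_on_image_set_diff[OF \<phi>, of I "{x}"] inj_on_image_set_diff[OF \<phi>, of I' "{y}"] gr xE yE by blast+
    then have im: "insert (\<phi> y) (\<phi> ` I - {\<phi> x}) = \<phi> ` insert y (I - {x})"
      "insert (\<phi> x) (\<phi> ` I' - {\<phi> y}) = \<phi> ` insert x (I' - {y})" by simp_all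
    have "\<exists>s. avoiding_sdr V A (\<phi> ` insert y (I - {x})) s" "\<exists>s. avoiding_sdr V A (\<phi> ` insert x (I' - {y})) s"
      using \<pi>[OF px] unfolding y(2) im by blast+
    moreover have "insert y (I - {x}) \<subseteq> es_ground E" "insert x (I' - {y}) \<subseteq> es_ground E"
      using gr xE yE by blast+
    ultimately have "indep_in ?Z (insert y (I - {x}))" "indep_in ?Z (insert x (I' - {y}))"
      using pres by blast+
    then show ?thesis using y by blast
  qed
  \<comment> \<open>The exchanges of \<open>a\<close> with \<open>\<gamma>\<close>, \<open>a\<close>
    with \<open>c\<close>, \<open>d\<close> with \<open>\<gamma>\<close> and \<open>d\<close> with
    \<open>c\<close> are blocked by \<open>c1\<close>, \<open>c2\<close>, \<open>c3\<close> and
    \<open>c4\<close> in this order.\<close>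
  have only_b: "y = ?s b" if y: "y \<in> I' - I" "x \<in> {?s a, ?s d}" "indep_in ?Z (insert y (I - {x}))"
    "indep_in ?Z (insert x (I' - {y}))" for x y
  proof (rule ccontr)
    assume "y \<noteq> ?s b"
    then have "y = ?g \<or> y = ?s c" using y(1) unfolding I_def I'_def by blast
    moreover have "\<not> indep_in ?Z (insert (?s a) (I' - {?g}))"
      by (rule dep[OF c1, of _ "?s a"]) (use K in \<open>auto simp: I'_def\<close>)
    moreover have "\<not> indep_in ?Z (insert (?s c) (I - {?s a}))"
      by (rule dep[OF c2, of _ "?s c"]) (use L aJ ne in \<open>auto simp: I_def\<close>)
    moreover have "\<not> indep_in ?Z (insert ?g (I - {?s d}))"
      by (rule dep[OF c3, of _ "?s a"]) (use ne in \<open>auto simp: I_def\<close>)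
    moreover have "\<not> indep_in ?Z (insert (?s d) (I' - {?s c}))"
      by (rule dep[OF c4, of _ "?s d"]) (use K L aJ ne in \<open>auto simp: I'_def\<close>)
    ultimately show False using y(2-4) by blast
  qed
  have "\<pi> (\<phi> (?s a)) = \<phi> (?s b)" "\<pi> (\<phi> (?s d)) = \<phi> (?s b)"
    using exch[of "?s a"] exch[of "?s d"] only_b by blast+
  then have "\<phi> (?s a) = \<phi> (?s d)" using inj by (auto dest: inj_onD)
  then show False using \<phi> aE ne by (auto dest: inj_onD)
qed

theorem theorem4p2:
  fixes B :: "'a matroid" and A :: "'a bmatrix"
  assumes "graphic_matroid B"
    and "vector_matroid A = B"
  shows "(\<forall>X e. X \<subseteq> ground B \<and> card X \<ge> 2 \<and> e \<in> X \<longrightarrow> binary_gammoid (es_splitting A X e))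
    \<longleftrightarrow> \<not> has_minor_iso B (cycle_matroid G\<^sub>8)"
proof -
  let ?Z = "matrix_cycles A"
  have ground: "ground B = cols A" using assms(2) unfolding vector_matroid_def by auto
  have fin: "finite (cols A)" using assms(1) ground unfolding graphic_matroid_def matroid_def by auto
  have Z: "cycle_space (cols A) ?Z" by (rule cycle_space_matrix_cycles[OF fin])
  have B: "B = space_matroid (cols A) ?Z" using vector_matroid_eq_space_matroid[OF fin] assms(2) by simp
  \<comment> \<open>Binarity is immediate because the es-splitting is a vector matroid; what remains
    is the presentation by representatives.\<close>
  have ES: "binary_gammoid (es_splitting A X e) \<longleftrightarrow> gammoid_space (es_ground (cols A)) (es_cycles (cols A) ?Z X e)"
    if e: "e \<in> cols A" for X e
  proof -
    let ?M = "es_splitting A X e"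
    let ?EZ = "es_cycles (cols A) ?Z X e"
    have M: "?M = space_matroid (es_ground (cols A)) ?EZ" by (rule es_splitting_eq_space_matroid[OF fin e])
    have mat: "matroid ?M" unfolding M by (rule matroid_space_matroid[OF cycle_space_es_cycles[OF Z]])
    then have "binary_matroid ?M" unfolding binary_matroid_def es_splitting_def element_splitting_def by blast
    moreover have "gammoid ?M \<longleftrightarrow> sdr_presented (ground ?M) (\<lambda>I. I \<in> indeps ?M)"
      using gammoid_imp_sdr_presented sdr_presented_imp_gammoid[OF mat] by blast
    moreover have "sdr_presented (ground ?M) (\<lambda>I. I \<in> indeps ?M) \<longleftrightarrow> gammoid_space (es_ground (cols A)) ?EZ"
      unfolding sdr_presented_def M space_matroid_def by simp
    ultimately show ?thesis unfolding binary_gammoid_def by simp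
  qed
  show ?thesis
  proof
    assume L: "\<forall>X e. X \<subseteq> ground B \<and> card X \<ge> 2 \<and> e \<in> X \<longrightarrow> binary_gammoid (es_splitting A X e)"
    show "\<not> has_minor_iso B (cycle_matroid G\<^sub>8)"
    proof
      assume "has_minor_iso B (cycle_matroid G\<^sub>8)"
      then obtain J a b c d K L where J: "J \<union> {a, b, c, d} \<subseteq> cols A" "J \<inter> {a, b, c, d} = {}" "distinct [a, b, c, d]"
        "indep_in ?Z (J \<union> {a, d})" "indep_in ?Z (J \<union> {b, c})"
        "K \<subseteq> J" "K \<union> {a, b, c} \<in> ?Z" "L \<subseteq> J" "L \<union> {c, d} \<in> ?Z"
        unfolding B by (rule has_minor_G8E[OF Z])
      have "{a, c} \<subseteq> ground B" "card {a, c} \<ge> 2" using J(1,3) ground by auto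
      then have "binary_gammoid (es_splitting A {a, c} a)" using L by blast
      then show False using ES[of a "{a, c}"] not_gammoid_es_splitting[OF Z J] J(1) by auto
    qed
  next
    assume "\<not> has_minor_iso B (cycle_matroid G\<^sub>8)"
    then have "theta_free ?Z" unfolding B by (rule theta_free_if_no_minor_G8[OF Z])
    then show "\<forall>X e. X \<subseteq> ground B \<and> card X \<ge> 2 \<and> e \<in> X \<longrightarrow> binary_gammoid (es_splitting A X e)"
      using ES gammoid_space_es_cycles[OF Z] unfolding ground by blast
  qed
qed

end
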